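(* There is an algorithm (called MinimumStarColoring in the paper) which, given any non-empty finite simple connected graph $G=(V,E)$ with node capacities $\kappa_v\in\mathbb{N}_{\ge 0}$ for $v\in V$, terminates after $\mathcal{O}(|E|^2)$ steps with the correct solution to the min-max star partitioning problem MinMaxStar on this input; that is, it outputs a valid star coloring $C$ with $x(G,C)=x^*(G)$, or correctly states that no valid star coloring exists.
   Context: Let $G=(V,E)$ be a finite simple graph with node capacities $\kappa_v\in\mathbb{N}_{\ge0}$. Each node $v\in V$ has its own distinct color $C(v)$. A star coloring $C$ assigns to each edge $e\in E$ a color $C(e)$ with $C(e)=C(v)$ for some endpoint $v\in e$. For $v\in V$ let $x(G,C,v)=|\{C(e):e\in E,\ v\in e\}|$ be the number of different colors of edges incident to $v$. The star coloring $C$ is valid if $x(G,C,v)\le\kappa_v$ for all $v\in V$. Let $x(G,C)=\max_{v\in V}x(G,C,v)$ and $x^*(G)=\min_C x(G,C)$, the minimum over all valid star colorings, with $x^*(G)=\infty$ if no valid star coloring exists. MinMaxStar: the input is a simple connected graph $G=(V,E)$ and capacities $\kappa_v\in\mathbb{N}_{\ge0}$; the output is a valid star coloring $C$ with $x(G,C)=x^*(G)$, or the statement that no valid star coloring exists. *)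

theory Defs
  imports Complex_Main "HOL-Library.Landau_Symbols" "HOL-Library.Extended_Nat"
begin

section \<open>Graphs and star colorings\<close>

definition simple_graph :: "'v set \<Rightarrow> 'v set set \<Rightarrow> bool" where
  "simple_graph V E \<longleftrightarrow> finite V \<and> (\<forall>e\<in>E. e \<subseteq> V \<and> card e = 2)"

definition connected_graph :: "'v set \<Rightarrow> 'v set set \<Rightarrow> bool" where
  "connected_graph V E \<longleftrightarrow> (\<forall>u\<in>V. \<forall>v\<in>V. (u, v) \<in> {(a, b). {a, b} \<in> E}\<^sup>*)"

text \<open>
  \<open>col\<close> gives the colors of the nodes (injective on the node set wherever it is used)
  and \<open>C\<close> those of the edges; only the values of \<open>C\<close> on \<open>E\<close> are relevant.
\<close>

definition star_coloring :: "'v set set \<Rightarrow> ('v \<Rightarrow> 'c) \<Rightarrow> ('v set \<Rightarrow> 'c) \<Rightarrow> bool" where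
  "star_coloring E col C \<longleftrightarrow> (\<forall>e\<in>E. \<exists>v\<in>e. C e = col v)"

definition num_colors_at :: "'v set set \<Rightarrow> ('v set \<Rightarrow> 'c) \<Rightarrow> 'v \<Rightarrow> nat" where
  "num_colors_at E C v = card {C e | e. e \<in> E \<and> v \<in> e}"

definition valid_star_coloring ::
  "'v set \<Rightarrow> 'v set set \<Rightarrow> ('v \<Rightarrow> nat) \<Rightarrow> ('v \<Rightarrow> 'c) \<Rightarrow> ('v set \<Rightarrow> 'c) \<Rightarrow> bool" where
  "valid_star_coloring V E \<kappa> col C \<longleftrightarrow>
     star_coloring E col C \<and> (\<forall>v\<in>V. num_colors_at E C v \<le> \<kappa> v)"

definition max_num_colors :: "'v set \<Rightarrow> 'v set set \<Rightarrow> ('v set \<Rightarrow> 'c) \<Rightarrow> nat" where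
  "max_num_colors V E C = Max ((\<lambda>v. num_colors_at E C v) ` V)"

text \<open>The infimum of the empty set of extended naturals is \<open>\<infinity>\<close>.\<close>

definition opt_num_colors ::
  "'v set \<Rightarrow> 'v set set \<Rightarrow> ('v \<Rightarrow> nat) \<Rightarrow> ('v \<Rightarrow> 'c) \<Rightarrow> enat" where
  "opt_num_colors V E \<kappa> col =
     (INF C \<in> {C. valid_star_coloring V E \<kappa> col C}. enat (max_num_colors V E C))"


section \<open>Machine model\<close>

text \<open>
  Algorithms are programs of a structured language for a random access machine with unit
  costs. The memory consists of arrays of natural numbers with unbounded index range; a
  program mentions only finitely many of them, and a scalar variable is an array used at
  index 0 only. The arithmetic operations are addition and truncated subtraction. There is no
  multiplication, which at unit cost on unbounded numbers would be unreasonably powerful.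
  Every evaluation of a node of an expression and every executed command or test counts as
  one step.
\<close>

type_synonym vname = string
type_synonym state = "vname \<Rightarrow> nat \<Rightarrow> nat"

datatype aexp = N nat | Read vname aexp | Add aexp aexp | Sub aexp aexp

datatype bexp = Less aexp aexp | Eq aexp aexp | Not bexp | And bexp bexp

datatype com =
    Skip
  | Write vname aexp aexp
  | Seq com com
  | If bexp com com
  | While bexp com

primrec aval :: "aexp \<Rightarrow> state \<Rightarrow> nat" where
  "aval (N n) s = n"
| "aval (Read x i) s = s x (aval i s)"
| "aval (Add a b) s = aval a s + aval b s"
| "aval (Sub a b) s = aval a s - aval b s"

primrec acost :: "aexp \<Rightarrow> nat" where
  "acost (N n) = 1"
| "acost (Read x i) = 1 + acost i"
| "acost (Add a b) = 1 + acost a + acost b"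
| "acost (Sub a b) = 1 + acost a + acost b"

primrec bval :: "bexp \<Rightarrow> state \<Rightarrow> bool" where
  "bval (Less a b) s \<longleftrightarrow> aval a s < aval b s"
| "bval (Eq a b) s \<longleftrightarrow> aval a s = aval b s"
| "bval (Not b) s \<longleftrightarrow> \<not> bval b s"
| "bval (And b c) s \<longleftrightarrow> bval b s \<and> bval c s"

primrec bcost :: "bexp \<Rightarrow> nat" where
  "bcost (Less a b) = 1 + acost a + acost b"
| "bcost (Eq a b) = 1 + acost a + acost b"
| "bcost (Not b) = 1 + bcost b"
| "bcost (And b c) = 1 + bcost b + bcost c"

text \<open>\<open>exec c s k t\<close>: started in \<open>s\<close>, the program \<open>c\<close> terminates after \<open>k\<close> steps in \<open>t\<close>.\<close>

inductive exec :: "com \<Rightarrow> state \<Rightarrow> nat \<Rightarrow> state \<Rightarrow> bool" where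
  Skip: "exec Skip s 1 s"
| Write: "exec (Write x i a) s (1 + acost i + acost a)
            (s(x := (s x)(aval i s := aval a s)))"
| Seq: "exec c1 s k1 s' \<Longrightarrow> exec c2 s' k2 t \<Longrightarrow> exec (Seq c1 c2) s (k1 + k2) t"
| IfTrue: "bval b s \<Longrightarrow> exec c1 s k t \<Longrightarrow> exec (If b c1 c2) s (1 + bcost b + k) t"
| IfFalse: "\<not> bval b s \<Longrightarrow> exec c2 s k t \<Longrightarrow> exec (If b c1 c2) s (1 + bcost b + k) t"
| WhileFalse: "\<not> bval b s \<Longrightarrow> exec (While b c) s (1 + bcost b) s"
| WhileTrue: "bval b s \<Longrightarrow> exec c s k1 s' \<Longrightarrow> exec (While b c) s' k2 t \<Longrightarrow>
    exec (While b c) s (1 + bcost b + k1 + k2) t"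

inductive_cases exec_SkipE: "exec Skip s k t"
inductive_cases exec_WriteE: "exec (Write x i a) s k t"
inductive_cases exec_SeqE: "exec (Seq c1 c2) s k t"
inductive_cases exec_IfE: "exec (If b c1 c2) s k t"
inductive_cases exec_WhileE: "exec (While b c) s k t"

text \<open>
  Execution is deterministic, so the existence of an execution with certain properties means
  that the program terminates and that its only execution has these properties.
\<close>

lemma exec_deterministic:
  "exec c s k t \<Longrightarrow> exec c s k' t' \<Longrightarrow> k' = k \<and> t' = t"
proof (induction arbitrary: k' t' rule: exec.induct)
  case (Skip s)
  then show ?case by (auto elim: exec_SkipE)
next
  case (Write x i a s)
  then show ?case by (auto elim: exec_WriteE)
next
  case (Seq c1 s k1 s' c2 k2 t)
  obtain l1 r l2 where "exec c1 s l1 r" "exec c2 r l2 t'" "k' = l1 + l2"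
    using Seq.prems by (rule exec_SeqE)
  with Seq.IH show ?case by metis
next
  case (IfTrue b s c1 k t c2)
  obtain l where "exec c1 s l t'" "k' = 1 + bcost b + l"
    using IfTrue.prems IfTrue.hyps(1) by (auto elim: exec_IfE)
  with IfTrue.IH show ?case by metis
next
  case (IfFalse b s c2 k t c1)
  obtain l where "exec c2 s l t'" "k' = 1 + bcost b + l"
    using IfFalse.prems IfFalse.hyps(1) by (auto elim: exec_IfE)
  with IfFalse.IH show ?case by metis
next
  case (WhileFalse b s c)
  show ?case
    by (rule exec_WhileE[OF WhileFalse.prems]) (use WhileFalse.hyps in simp_all)
next
  case (WhileTrue b s c k1 s' k2 t)
  obtain l1 r l2 where "exec c s l1 r" "exec (While b c) r l2 t'" "k' = 1 + bcost b + l1 + l2"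
    by (rule exec_WhileE[OF WhileTrue.prems]) (use WhileTrue.hyps(1) in auto)
  with WhileTrue.IH show ?case by metis
qed


section \<open>Input and output of programs\<close>

text \<open>
  A graph is presented by an enumeration \<open>vs\<close> of its nodes and a list \<open>es\<close> of its edges, each
  given as a pair of positions in \<open>vs\<close>. Nodes, edges and pair components come in arbitrary
  order. The program has access only to positions, not to the nodes themselves.
\<close>

definition edge_of :: "'v list \<Rightarrow> nat \<times> nat \<Rightarrow> 'v set" where
  "edge_of vs p = {vs ! fst p, vs ! snd p}"

definition represents ::
  "'v list \<Rightarrow> (nat \<times> nat) list \<Rightarrow> 'v set \<Rightarrow> 'v set set \<Rightarrow> bool" where
  "represents vs es V E \<longleftrightarrow>
     distinct vs \<and> set vs = V \<and>
     (\<forall>p\<in>set es. fst p < length vs \<and> snd p < length vs) \<and>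
     distinct (map (edge_of vs) es) \<and> set (map (edge_of vs) es) = E"

definition scalar :: "nat \<Rightarrow> nat \<Rightarrow> nat" where
  "scalar n = (\<lambda>i. if i = 0 then n else 0)"

definition array :: "nat list \<Rightarrow> nat \<Rightarrow> nat" where
  "array xs = (\<lambda>i. if i < length xs then xs ! i else 0)"

definition input_state :: "'v list \<Rightarrow> (nat \<times> nat) list \<Rightarrow> ('v \<Rightarrow> nat) \<Rightarrow> state" where
  "input_state vs es \<kappa> = (\<lambda>_ _. 0)
     (''n'' := scalar (length vs),
      ''m'' := scalar (length es),
      ''src'' := array (map fst es),
      ''dst'' := array (map snd es),
      ''cap'' := array (map \<kappa> vs))"

text \<open>
  The final value of \<open>''found''\<close> tells whether a coloring is output; if so, \<open>''center''\<close> holds, for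
  each position in \<open>es\<close>, the position in \<open>vs\<close> of a node whose color the edge receives.
\<close>

definition output_coloring ::
  "'v list \<Rightarrow> (nat \<times> nat) list \<Rightarrow> ('v \<Rightarrow> 'c) \<Rightarrow> state \<Rightarrow> ('v set \<Rightarrow> 'c) \<Rightarrow> bool" where
  "output_coloring vs es col t C \<longleftrightarrow>
     (\<forall>i<length es. t ''center'' i < length vs \<and>
        C (edge_of vs (es ! i)) = col (vs ! t ''center'' i))"

definition correct_output ::
  "'v set \<Rightarrow> 'v set set \<Rightarrow> ('v \<Rightarrow> nat) \<Rightarrow> ('v \<Rightarrow> 'c) \<Rightarrow>
   'v list \<Rightarrow> (nat \<times> nat) list \<Rightarrow> state \<Rightarrow> bool" where
  "correct_output V E \<kappa> col vs es t \<longleftrightarrow>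
     t ''found'' 0 = 1 \<and>
       (\<exists>C. output_coloring vs es col t C \<and> valid_star_coloring V E \<kappa> col C \<and>
            enat (max_num_colors V E C) = opt_num_colors V E \<kappa> col) \<or>
     t ''found'' 0 = 0 \<and> \<not> (\<exists>C. valid_star_coloring V E \<kappa> col C)"

end

theory Submission
  imports Defs
begin

text \<open>
  A star coloring selects one end of each edge as its \<^emph>\<open>center\<close>, whose color the edge receives;
  call the other end the \<^emph>\<open>leaf\<close> and let the \<^emph>\<open>load\<close> of a node be the number of edges of which it
  is the leaf. A node sees a different color for each unit of its load, and in addition its own
  color if its load is smaller than its degree (\<open>num_colors_at_eq\<close>). Therefore an upper bound on
  the number of colors at a node is the same as an upper bound on its load
  (\<open>num_colors_at_le_iff\<close>), and to find a valid coloring with at most \<open>k\<close> colors at each node means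
  to orient the edges such that the indegrees obey given bounds.

  This can be solved with augmenting paths. From an overloaded node, walk along edges from leaf to
  center. If a node with room is reached, exchange centers and leaves along the path; the total
  excess over the bounds decreases (\<open>excess_path_flip\<close>). If not, the reached nodes form a set that no
  edge with a leaf in it leaves. Such an edge has its leaf in the set for all choices of centers, so
  the set is overloaded for all of them, and the bounds cannot be met
  (\<open>closed_overloaded_set_infeasible\<close>).

  The program starts with \<open>k = 1\<close> and arbitrary centers. It increases \<open>k\<close> only after a search has
  failed, that is, when \<open>k\<close> colors have turned out not to suffice, so the coloring found in the end is
  optimal. When a search fails with \<open>k \<ge> |E|\<close>, only the capacities matter and no valid coloring exists.

  For the running time it is decisive that the centers are kept when \<open>k\<close> is increased. The bounds
  grow with \<open>k\<close>, so the total excess never increases, and it is at most \<open>|E| + |V|\<close> initially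
  (\<open>excess_le\<close>). As \<open>k\<close> increases at most \<open>|E|\<close> times, there are \<open>O(|E| + |V|)\<close> searches. Each of them
  is a depth-first search that scans every edge at most once, with linked lists of edges rebuilt
  beforehand, and takes \<open>O(|E| + |V|)\<close> steps. Finally \<open>|V| \<le> |E| + 1\<close> because the graph is connected
  (\<open>connected_graph_card_le\<close>).
\<close>

section \<open>Loads and augmenting paths\<close>

text \<open>
  \<open>threshold d l\<close> is the strict bound on the load of a node of degree \<open>d\<close> that expresses the
  bound \<open>l\<close> on its colors. If \<open>d \<le> l\<close>, every load is admissible. Otherwise a load of \<open>l\<close> would
  leave an edge of which the node is the center, whose color is one too many; thus the load has
  to be smaller than \<open>l\<close>, which for \<open>l = 0\<close> is rightly impossible.
\<close>

definition threshold :: "nat \<Rightarrow> nat \<Rightarrow> nat" where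
  "threshold d l = (if d \<le> l then d + 1 else l)"

lemma colors_le_iff_load_less_threshold:
  "a \<le> d \<Longrightarrow> a + of_bool (a < d) \<le> l \<longleftrightarrow> a < threshold d l"
  by (auto simp: threshold_def)

lemma threshold_mono: "l \<le> l' \<Longrightarrow> threshold d l \<le> threshold d l'"
  by (auto simp: threshold_def)

lemma threshold_min: "d \<le> k \<Longrightarrow> threshold d (min l k) = threshold d l"
  by (auto simp: threshold_def)

text \<open>
  Nodes are the numbers below \<open>n\<close> and edges the numbers below \<open>m\<close>. A star coloring is a function
  \<open>c\<close> that selects the center of each edge, the endpoint that gives it its color.
\<close>

locale edge_list =
  fixes n m :: nat and src dst :: "nat \<Rightarrow> nat"
  assumes src_less: "i < m \<Longrightarrow> src i < n"
    and dst_less: "i < m \<Longrightarrow> dst i < n"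
    and no_loop: "i < m \<Longrightarrow> src i \<noteq> dst i"
begin

definition centers :: "(nat \<Rightarrow> nat) \<Rightarrow> bool" where
  "centers c \<longleftrightarrow> (\<forall>i<m. c i = src i \<or> c i = dst i)"

text \<open>
  The end of an edge that is not its center is obtained by arithmetic on the two ends, just as
  the program does it.
\<close>

definition leaf :: "(nat \<Rightarrow> nat) \<Rightarrow> nat \<Rightarrow> nat" where
  "leaf c i = src i + dst i - c i"

definition load :: "(nat \<Rightarrow> nat) \<Rightarrow> nat \<Rightarrow> nat" where
  "load c v = card {i. i < m \<and> leaf c i = v}"

definition deg :: "nat \<Rightarrow> nat" where
  "deg v = card {i. i < m \<and> (src i = v \<or> dst i = v)}"

definition fits :: "(nat \<Rightarrow> nat) \<Rightarrow> (nat \<Rightarrow> nat) \<Rightarrow> bool" where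
  "fits l c \<longleftrightarrow> (\<forall>v<n. load c v < threshold (deg v) (l v))"

definition feasible :: "(nat \<Rightarrow> nat) \<Rightarrow> bool" where
  "feasible l \<longleftrightarrow> (\<exists>c. centers c \<and> fits l c)"

abbreviation capped :: "(nat \<Rightarrow> nat) \<Rightarrow> nat \<Rightarrow> nat \<Rightarrow> nat" where
  "capped cap k v \<equiv> min (cap v) k"

text \<open>
  The term of a node is the amount by which its load exceeds the largest admissible one, which is
  \<open>threshold - 1\<close>; formally this is \<open>- 1\<close> if the threshold is \<open>0\<close>.
\<close>

definition excess :: "(nat \<Rightarrow> nat) \<Rightarrow> (nat \<Rightarrow> nat) \<Rightarrow> nat" where
  "excess l c = (\<Sum>v<n. load c v + 1 - threshold (deg v) (l v))"

lemma leaf_cases: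
  assumes "centers c" "i < m"
  shows "c i = src i \<and> leaf c i = dst i \<or> c i = dst i \<and> leaf c i = src i"
  using assms by (auto simp: centers_def leaf_def)

lemma leaf_less: "centers c \<Longrightarrow> i < m \<Longrightarrow> leaf c i < n"
  using leaf_cases[of c i] src_less[of i] dst_less[of i] by auto

lemma center_less: "centers c \<Longrightarrow> i < m \<Longrightarrow> c i < n"
  using leaf_cases[of c i] src_less[of i] dst_less[of i] by auto

lemma leaf_neq_center: "centers c \<Longrightarrow> i < m \<Longrightarrow> leaf c i \<noteq> c i"
  using leaf_cases[of c i] no_loop[of i] by auto

lemma load_le_deg: "centers c \<Longrightarrow> load c v \<le> deg v"
  unfolding load_def deg_def by (rule card_mono) (auto dest: leaf_cases)

lemma deg_le: "deg v \<le> m"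
proof -
  have "deg v \<le> card {..<m}" unfolding deg_def by (rule card_mono) auto
  then show ?thesis by simp
qed

text \<open>
  A node sees its own color exactly if some incident edge does not count towards its load.
\<close>

lemma load_less_deg_iff:
  assumes "centers c"
  shows "load c v < deg v \<longleftrightarrow> (\<exists>i<m. c i = v)"
proof -
  have "{i. i < m \<and> (src i = v \<or> dst i = v)} = {i. i < m \<and> leaf c i = v} \<union> {i. i < m \<and> c i = v}"
  proof (rule set_eqI)
    fix i
    show "i \<in> {i. i < m \<and> (src i = v \<or> dst i = v)} \<longleftrightarrow>
        i \<in> {i. i < m \<and> leaf c i = v} \<union> {i. i < m \<and> c i = v}"
    proof (cases "i < m")
      case True
      then have "{src i, dst i} = {leaf c i, c i}"
        using leaf_cases[OF assms True] by (elim disjE conjE; simp only: insert_commute)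
      then have "v \<in> {src i, dst i} \<longleftrightarrow> v \<in> {leaf c i, c i}" by simp
      then show ?thesis using True by (simp add: eq_commute)
    qed simp
  qed
  moreover have "{i. i < m \<and> leaf c i = v} \<inter> {i. i < m \<and> c i = v} = {}"
  proof (rule equals0I)
    fix i assume "i \<in> {i. i < m \<and> leaf c i = v} \<inter> {i. i < m \<and> c i = v}"
    then have "i < m" "leaf c i = v" "c i = v" by simp_all
    then show False using leaf_neq_center[OF assms, of i] by simp
  qed
  ultimately have "deg v = load c v + card {i. i < m \<and> c i = v}"
    unfolding deg_def load_def by (simp add: card_Un_disjoint)
  moreover have "0 < card {i. i < m \<and> c i = v} \<longleftrightarrow> (\<exists>i<m. c i = v)"
    by (auto simp: card_gt_0_iff)
  ultimately show ?thesis by simp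
qed

lemma sum_load:
  assumes "finite R"
  shows "(\<Sum>v\<in>R. load c v) = card {i. i < m \<and> leaf c i \<in> R}"
proof -
  have "card {i. i < m \<and> leaf c i \<in> R} = card (\<Union>v\<in>R. {i. i < m \<and> leaf c i = v})"
    by (rule arg_cong[where f = card]) auto
  also have "\<dots> = (\<Sum>v\<in>R. load c v)"
    unfolding load_def by (rule card_UN_disjoint) (use assms in auto)
  finally show ?thesis by simp
qed

lemma excess_le: "excess l c \<le> m + n"
proof -
  have "excess l c \<le> (\<Sum>v<n. load c v + 1)"
    unfolding excess_def by (rule sum_mono) simp
  also have "\<dots> = (\<Sum>v<n. load c v) + n" by (simp only: sum.distrib) simp
  also have "(\<Sum>v<n. load c v) \<le> m"
  proof -
    have "card {i. i < m \<and> leaf c i \<in> {..<n}} \<le> card {..<m}" by (rule card_mono) auto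
    then show ?thesis by (simp add: sum_load)
  qed
  finally show ?thesis by simp
qed

lemma excess_antimono: "(\<And>v. l v \<le> l' v) \<Longrightarrow> excess l' c \<le> excess l c"
  unfolding excess_def by (intro sum_mono diff_le_mono2 threshold_mono)

text \<open>
  The sums with \<open>of_bool\<close> on both sides say, without truncated subtraction, that one unit of load
  moves from the leaf of \<open>e\<close> to its center.
\<close>

lemma load_flip:
  assumes "centers c" "e < m"
  shows "load (c(e := leaf c e)) v + of_bool (v = leaf c e) = load c v + of_bool (v = c e)"
proof -
  let ?c = "c(e := leaf c e)"
  define A where "A = {i. i < m \<and> i \<noteq> e \<and> leaf c i = v}"
  have e: "leaf ?c e = c e" using assms leaf_cases[OF assms] by (auto simp: leaf_def)
  have o: "leaf ?c i = leaf c i" if "i \<noteq> e" for i using that by (simp add: leaf_def)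
  have 1: "{i. i < m \<and> leaf ?c i = v} = (if v = c e then insert e A else A)"
    using e o assms(2) unfolding A_def by (auto; metis)
  have 2: "{i. i < m \<and> leaf c i = v} = (if v = leaf c e then insert e A else A)"
    using assms(2) unfolding A_def by auto
  have "finite A" "e \<notin> A" unfolding A_def by auto
  then show ?thesis
    unfolding load_def 1 2 using leaf_neq_center[OF assms] by auto
qed

lemma centers_flip: "centers c \<Longrightarrow> e < m \<Longrightarrow> centers (c(e := leaf c e))"
  using leaf_cases[of c e] by (auto simp: centers_def)

text \<open>
  The certificate that a failed search leaves behind. Every edge whose leaf lies in \<open>R\<close> has both
  ends in \<open>R\<close>, so that it has its leaf in \<open>R\<close> for every other choice of centers as well. Hence the
  total load of \<open>R\<close> cannot become smaller, but it is too large: no node of \<open>R\<close> has room and \<open>r\<close> is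
  overloaded.
\<close>

lemma closed_overloaded_set_infeasible:
  assumes "centers c" "R \<subseteq> {..<n}"
    and closed: "\<And>i. i < m \<Longrightarrow> leaf c i \<in> R \<Longrightarrow> c i \<in> R"
    and full: "\<And>v. v \<in> R \<Longrightarrow> threshold (deg v) (l v) \<le> load c v + 1"
    and r: "r \<in> R" "threshold (deg r) (l r) \<le> load c r"
  shows "\<not> feasible l"
proof
  assume "feasible l"
  then obtain c' where c': "centers c'" "fits l c'" by (auto simp: feasible_def)
  have fin: "finite R" using assms(2) by (rule finite_subset) simp
  have "leaf c' i \<in> R" if "i < m" "leaf c i \<in> R" for i
    using leaf_cases[OF assms(1) that(1)] leaf_cases[OF c'(1) that(1)] closed[OF that] that
    by auto
  then have le: "(\<Sum>v\<in>R. load c v) \<le> (\<Sum>v\<in>R. load c' v)"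
    unfolding sum_load[OF fin] by (intro card_mono) auto
  have "(\<Sum>v\<in>R. load c' v + 1) \<le> (\<Sum>v\<in>R. threshold (deg v) (l v))"
    using c'(2) assms(2) unfolding fits_def by (intro sum_mono) (simp add: Suc_le_eq subset_iff)
  also have "\<dots> < (\<Sum>v\<in>R. load c v + 1)"
  proof (rule sum_strict_mono_ex1[OF fin])
    show "\<exists>v\<in>R. threshold (deg v) (l v) < load c v + 1" using r by (intro bexI[of _ r]) auto
  qed (use full in blast)
  finally show False using le unfolding sum.distrib by simp
qed

text \<open>
  The excess strictly decreases because the overloaded node \<open>r\<close> gives a unit of load to a node
  \<open>u\<close> that can take it without exceeding its own threshold.
\<close>

lemma excess_path_flip:
  assumes "r < n" "u < n"
    and load: "\<And>v. load c' v + of_bool (v = r) = load c v + of_bool (v = u)"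
    and r: "threshold (deg r) (l r) \<le> load c r"
    and u: "load c u + 1 < threshold (deg u) (l u)"
  shows "excess l c' < excess l c"
  unfolding excess_def
proof (rule sum_strict_mono_ex1)
  have ne: "r \<noteq> u" using r u by auto
  show "\<forall>v\<in>{..<n}. load c' v + 1 - threshold (deg v) (l v) \<le> load c v + 1 - threshold (deg v) (l v)"
  proof
    fix v show "load c' v + 1 - threshold (deg v) (l v) \<le> load c v + 1 - threshold (deg v) (l v)"
      using load[of v] u by (cases "v = r"; cases "v = u") auto
  qed
  show "\<exists>v\<in>{..<n}. load c' v + 1 - threshold (deg v) (l v) < load c v + 1 - threshold (deg v) (l v)"
    using load[of r] ne r assms(1) by (intro bexI[of _ r]) auto
qed simp

section \<open>Depth-first search for a node with room\<close>

text \<open>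
  For every node, the edges with this node as leaf form a linked list. A pointer is \<open>e + 1\<close> for
  the edge \<open>e\<close> and \<open>0\<close> at the end of a list. Edges are inserted at the front in increasing order,
  so that pointers decrease along a list. The set of edges of a list from a pointer \<open>p\<close> on
  is therefore known without any induction along the list: it consists of the edges \<open>e < p\<close> with
  the given leaf. The number \<open>j\<close> is that of the edges inserted so far.
\<close>

definition linked :: "(nat \<Rightarrow> nat) \<Rightarrow> nat \<Rightarrow> (nat \<Rightarrow> nat) \<Rightarrow> (nat \<Rightarrow> nat) \<Rightarrow> bool" where
  "linked c j first nxt \<longleftrightarrow>
     (\<forall>v<n. first v \<le> j \<and> (0 < first v \<longrightarrow> leaf c (first v - 1) = v)) \<and>
     (\<forall>e<j. e < first (leaf c e)) \<and>
     (\<forall>e<j. nxt e \<le> e \<and> (0 < nxt e \<longrightarrow> leaf c (nxt e - 1) = leaf c e) \<and>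
            (\<forall>e'<e. leaf c e' = leaf c e \<longrightarrow> e' < nxt e))"

lemma linked_Suc:
  assumes "linked c j first nxt" "centers c" "j < m"
  shows "linked c (Suc j) (first(leaf c j := Suc j)) (nxt(j := first (leaf c j)))"
  using assms leaf_less[OF assms(2)] unfolding linked_def
  by (auto simp: less_Suc_eq le_Suc_eq)

lemma load_prefix_Suc:
  "card {i. i < Suc j \<and> leaf c i = v} = card {i. i < j \<and> leaf c i = v} + of_bool (leaf c j = v)"
proof -
  have "{i. i < Suc j \<and> leaf c i = v} =
      (if leaf c j = v then insert j {i. i < j \<and> leaf c i = v} else {i. i < j \<and> leaf c i = v})"
    by (auto simp: less_Suc_eq)
  then show ?thesis by simp
qed

lemma deg_prefix_Suc:
  assumes "j < m"
  shows "card {i. i < Suc j \<and> (src i = v \<or> dst i = v)} =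
    card {i. i < j \<and> (src i = v \<or> dst i = v)} + of_bool (src j = v) + of_bool (dst j = v)"
proof -
  let ?A = "{i. i < j \<and> (src i = v \<or> dst i = v)}"
  have "{i. i < Suc j \<and> (src i = v \<or> dst i = v)} =
      (if src j = v \<or> dst j = v then insert j ?A else ?A)"
    by (auto simp: less_Suc_eq)
  then show ?thesis using no_loop[OF assms] by auto
qed

text \<open>
  The search starts in \<open>r\<close> and walks along edges from leaf to center. The first \<open>h\<close> entries of
  \<open>stack\<close> are the path to the current node, whose \<open>i\<close>-th node is entered through the edge
  \<open>via i\<close>. Scanning an edge removes it from its list, that is, \<open>first v\<close> advances; so the edges
  \<open>e \<ge> first v\<close> with leaf \<open>v\<close> are the scanned ones, and their centers are marked. A marked node
  that has left the stack is exhausted and has no room (\<open>full\<close>).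
\<close>

definition dfs_inv where
  "dfs_inv c full r first mark stack via h \<longleftrightarrow>
     r < n \<and> mark r \<noteq> (0::nat) \<and> (0 < (h::nat) \<longrightarrow> stack 0 = r) \<and>
     (\<forall>i<h. stack i < n \<and> mark (stack i) \<noteq> 0) \<and> inj_on stack {..<h} \<and>
     (\<forall>i. 0 < i \<and> i < h \<longrightarrow> via i < m \<and> leaf c (via i) = stack (i - 1) \<and> c (via i) = stack i) \<and>
     (\<forall>v<n. first v \<le> m \<and> (0 < first v \<longrightarrow> leaf c (first v - 1) = v)) \<and>
     (\<forall>e<m. first (leaf c e) \<le> e \<longrightarrow> mark (c e) \<noteq> 0) \<and>
     (\<forall>v<n. mark v \<noteq> 0 \<longrightarrow> v \<in> stack ` {..<h} \<or> first v = 0 \<and> full v)"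

lemma dfs_invD:
  assumes "dfs_inv c full r first mark stack via h"
  shows "r < n" "0 < h \<Longrightarrow> stack 0 = r"
    "\<And>i. i < h \<Longrightarrow> stack i < n" "\<And>i. i < h \<Longrightarrow> mark (stack i) \<noteq> 0" "inj_on stack {..<h}"
    "\<And>i. 0 < i \<Longrightarrow> i < h \<Longrightarrow> via i < m \<and> leaf c (via i) = stack (i - 1) \<and> c (via i) = stack i"
    "\<And>v. v < n \<Longrightarrow> 0 < first v \<Longrightarrow> leaf c (first v - 1) = v"
    "\<And>v. v < n \<Longrightarrow> first v \<le> m"
    "\<And>e. e < m \<Longrightarrow> first (leaf c e) \<le> e \<Longrightarrow> mark (c e) \<noteq> 0"
    "\<And>v. v < n \<Longrightarrow> mark v \<noteq> 0 \<Longrightarrow> v \<in> stack ` {..<h} \<or> first v = 0 \<and> full v"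
  by (insert assms, unfold dfs_inv_def, elim conjE, simp; fail)+

lemma dfs_height:
  assumes "dfs_inv c full r first mark stack via h"
  shows "h \<le> n"
proof -
  have "card {..<h} \<le> card {..<n}"
    by (rule card_inj_on_le[of stack]) (use dfs_invD(3,5)[OF assms] in auto)
  then show ?thesis by simp
qed

text \<open>
  The amortized cost of the search: each step that is not a pop reduces this number or ends the
  search.
\<close>

definition unscanned :: "(nat \<Rightarrow> nat) \<Rightarrow> (nat \<Rightarrow> nat) \<Rightarrow> nat" where
  "unscanned c first = card {e. e < m \<and> e < first (leaf c e)}"

lemma unscanned_le: "unscanned c first \<le> m"
proof -
  have "unscanned c first \<le> card {..<m}" unfolding unscanned_def by (rule card_mono) auto
  then show ?thesis by simp
qed

lemma unscanned_next:
  assumes "centers c" "linked c m first0 nxt" "v < n" "first v = Suc e" "e < m" "leaf c e = v"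
  shows "unscanned c (first(v := nxt e)) < unscanned c first"
  unfolding unscanned_def
proof (rule psubset_card_mono)
  have "nxt e \<le> e" using assms unfolding linked_def by auto
  then have "{e'. e' < m \<and> e' < (first(v := nxt e)) (leaf c e')} \<subseteq> {e. e < m \<and> e < first (leaf c e)} - {e}"
    using assms by (auto split: if_splits)
  moreover have "e \<in> {e. e < m \<and> e < first (leaf c e)}" using assms by auto
  ultimately show "{e'. e' < m \<and> e' < (first(v := nxt e)) (leaf c e')} \<subset> {e. e < m \<and> e < first (leaf c e)}"
    by blast
qed simp

lemma dfs_init:
  assumes "r < n" "linked c m first nxt" "\<forall>v<n. mark v = 0"
  shows "dfs_inv c full r first (mark(r := Suc 0)) (stack(0 := r)) via (Suc 0)"
proof -
  have "\<not> first (leaf c e) \<le> e" if "e < m" for e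
    using assms(2) that unfolding linked_def by (simp add: not_le)
  moreover have "inj_on (stack(0 := r)) {..<Suc 0}" by (simp add: lessThan_Suc)
  ultimately show ?thesis using assms unfolding dfs_inv_def linked_def by (simp add: lessThan_Suc)
qed

lemma dfs_pop:
  assumes inv: "dfs_inv c full r first mark stack via (Suc t)" and "first (stack t) = 0" "full (stack t)"
  shows "dfs_inv c full r first mark stack via t"
  using assms unfolding dfs_inv_def by (auto simp: lessThan_Suc inj_on_def)

lemma dfs_edge:
  assumes "dfs_inv c full r first mark stack via (Suc t)" "first (stack t) \<noteq> 0"
  obtains e where "first (stack t) = Suc e" "e < m" "leaf c e = stack t" "stack t < n"
proof -
  obtain e where e: "first (stack t) = Suc e" using assms(2) by (cases "first (stack t)") auto
  then show thesis using that[of e] assms(1) unfolding dfs_inv_def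
    by (metis Suc_le_lessD diff_Suc_1 lessI zero_less_Suc)
qed

text \<open>
  The scanning node may lie anywhere on the stack, so that the lemma also applies after
  \<open>dfs_mark\<close> has put the center of the scanned edge on top of it.
\<close>

lemma dfs_scan:
  assumes c: "centers c" and l: "linked c m first0 nxt"
    and inv: "dfs_inv c full r first mark stack via h"
    and v: "v \<in> stack ` {..<h}"
    and e: "first v = Suc e" "e < m" "leaf c e = v" and mark: "mark (c e) \<noteq> 0"
  shows "dfs_inv c full r (first(v := nxt e)) mark stack via h"
proof -
  have n: "nxt e \<le> e" "0 < nxt e \<Longrightarrow> leaf c (nxt e - 1) = v"
    "\<And>e'. e' < e \<Longrightarrow> leaf c e' = v \<Longrightarrow> e' < nxt e"
    using l e unfolding linked_def by auto
  have a: "mark (c e') \<noteq> 0" if "e' < m" "(first(v := nxt e)) (leaf c e') \<le> e'" for e'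
  proof (cases "leaf c e' = v")
    case True
    with that n(3)[of e'] have "e \<le> e'" by (auto simp: not_less[symmetric])
    then show ?thesis using True mark inv that(1) e unfolding dfs_inv_def
      by (cases "e' = e") auto
  next
    case False
    then show ?thesis using that inv unfolding dfs_inv_def by auto
  qed
  have b: "nxt e \<le> m" using n e by simp
  show ?thesis
    unfolding dfs_inv_def
  proof (intro conjI)
    show "\<forall>x<n. (first(v := nxt e)) x \<le> m \<and> (0 < (first(v := nxt e)) x \<longrightarrow> leaf c ((first(v := nxt e)) x - 1) = x)"
      using dfs_invD(7,8)[OF inv] b n(2) by simp
    show "\<forall>x<n. mark x \<noteq> 0 \<longrightarrow> x \<in> stack ` {..<h} \<or> (first(v := nxt e)) x = 0 \<and> full x"
      using dfs_invD(10)[OF inv] v by auto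
  qed (use inv a in \<open>simp_all add: dfs_inv_def\<close>)
qed

lemma dfs_mark:
  assumes c: "centers c" and inv: "dfs_inv c full r first mark stack via (Suc t)"
    and e: "e < m" "leaf c e = stack t" and mark: "mark (c e) = 0"
  shows "dfs_inv c full r first (mark(c e := 1)) (stack(Suc t := c e)) (via(Suc t := e)) (Suc (Suc t))"
proof -
  have cn: "c e < n" using c e center_less by blast
  have stack: "stack i \<noteq> c e" if "i < Suc t" for i
  proof -
    have "mark (stack i) \<noteq> 0" using dfs_invD(4)[OF inv that] .
    then show ?thesis using mark by (cases "stack i = c e") simp_all
  qed
  have fresh: "c e \<notin> stack ` {..<Suc t}"
  proof
    assume "c e \<in> stack ` {..<Suc t}"
    then obtain i where "i < Suc t" "stack i = c e" by (elim imageE) simp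
    then show False using stack by simp
  qed
  have inj: "inj_on (stack(Suc t := c e)) {..<Suc (Suc t)}"
  proof -
    have "inj_on stack {..<Suc t}" using inv by (rule dfs_invD)
    then have "inj_on (stack(Suc t := c e)) {..<Suc t}" using fresh by (rule inj_on_fun_updI)
    moreover have "(stack(Suc t := c e)) ` {..<Suc t} = stack ` {..<Suc t}" by (rule image_cong) auto
    ultimately show ?thesis using fresh by (subst lessThan_Suc) auto
  qed
  have im: "(stack(Suc t := c e)) ` {..<Suc (Suc t)} = insert (c e) (stack ` {..<Suc t})"
    by (auto simp: lessThan_Suc)
  show ?thesis
    unfolding dfs_inv_def im
  proof (intro conjI)
    show "\<forall>i<Suc (Suc t). (stack(Suc t := c e)) i < n \<and> (mark(c e := 1)) ((stack(Suc t := c e)) i) \<noteq> 0"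
      using dfs_invD(3,4)[OF inv] cn by (simp add: less_Suc_eq)
    show "\<forall>i. 0 < i \<and> i < Suc (Suc t) \<longrightarrow> (via(Suc t := e)) i < m \<and>
        leaf c ((via(Suc t := e)) i) = (stack(Suc t := c e)) (i - 1) \<and>
        c ((via(Suc t := e)) i) = (stack(Suc t := c e)) i"
    proof (intro allI impI)
      fix i assume i: "0 < i \<and> i < Suc (Suc t)"
      show "(via(Suc t := e)) i < m \<and>
        leaf c ((via(Suc t := e)) i) = (stack(Suc t := c e)) (i - 1) \<and>
        c ((via(Suc t := e)) i) = (stack(Suc t := c e)) i"
      proof (cases "i = Suc t")
        case True
        then show ?thesis using e by simp
      next
        case False
        then have "i < Suc t" "i - 1 < Suc t" using i by auto
        moreover from this have "via i < m \<and> leaf c (via i) = stack (i - 1) \<and> c (via i) = stack i"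
          using dfs_invD(6)[OF inv, of i] i by blast
        ultimately show ?thesis by simp
      qed
    qed
    show "\<forall>v<n. (mark(c e := 1)) v \<noteq> 0 \<longrightarrow> v \<in> insert (c e) (stack ` {..<Suc t}) \<or> first v = 0 \<and> full v"
      using dfs_invD(10)[OF inv] by simp
  qed (use inv inj in \<open>simp_all add: dfs_inv_def\<close>)
qed

text \<open>
  When the stack is empty, all edges at marked nodes have been scanned, and the marked nodes are
  a closed set as in \<open>closed_overloaded_set_infeasible\<close>.
\<close>

lemma dfs_exhausted:
  assumes "centers c" and inv: "dfs_inv c full r first mark stack via 0"
    and full: "\<And>v. v < n \<Longrightarrow> full v \<Longrightarrow> threshold (deg v) (l v) \<le> load c v + 1"
    and r: "threshold (deg r) (l r) \<le> load c r"
  shows "\<not> feasible l"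
proof (rule closed_overloaded_set_infeasible[of c "{v. v < n \<and> mark v \<noteq> 0}" l r])
  have finished: "first v = 0 \<and> full v" if "v < n" "mark v \<noteq> 0" for v
    using dfs_invD(10)[OF inv that] by simp
  show "threshold (deg v) (l v) \<le> load c v + 1" if "v \<in> {v. v < n \<and> mark v \<noteq> 0}" for v
    using that full finished by simp
  show "c i \<in> {v. v < n \<and> mark v \<noteq> 0}" if "i < m" "leaf c i \<in> {v. v < n \<and> mark v \<noteq> 0}" for i
    using that finished[of "leaf c i"] dfs_invD(9)[OF inv that(1)] center_less[OF assms(1) that(1)] by simp
  show "r \<in> {v. v < n \<and> mark v \<noteq> 0}"
    using inv unfolding dfs_inv_def by simp
qed (use assms in auto)

text \<open>
  State of the exchange of centers and leaves along the path on the stack, from its last node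
  \<open>stack t\<close> backwards: it remains to treat the edges \<open>via i\<close> with \<open>i < h\<close>, and up to now the
  unit of load that \<open>stack t\<close> receives comes from \<open>stack (h - 1)\<close>.
\<close>

definition path_inv where
  "path_inv c stack via t h c' \<longleftrightarrow> centers c' \<and>
     (\<forall>i. 0 < i \<and> i < (h::nat) \<longrightarrow> c' (via i) = c (via i)) \<and>
     (\<forall>v. load c' v + of_bool (v = stack (h - 1)) = load c v + of_bool (v = stack t))"

lemma path_step:
  assumes dfs: "dfs_inv c full r first mark stack via (Suc t)"
    and inv: "path_inv c stack via t (Suc j) c'" and j: "0 < j" "j \<le> t"
  shows "path_inv c stack via t j (c'(via j := leaf c' (via j)))"
proof -
  have via: "\<And>i. 0 < i \<Longrightarrow> i \<le> t \<Longrightarrow> via i < m \<and> leaf c (via i) = stack (i - 1) \<and> c (via i) = stack i"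
    and inj: "inj_on stack {..<Suc t}"
    using dfs unfolding dfs_inv_def by auto
  have m: "via j < m" using via j by simp
  have c': "centers c'" "c' (via j) = stack j" "leaf c' (via j) = stack (j - 1)"
    using inv via[of j] j unfolding path_inv_def leaf_def by auto
  \<comment> \<open>The nodes on the stack are distinct, hence so are the edges, and the step does not disturb the rest of the path.\<close>
  have ne: "via i \<noteq> via j" if "0 < i" "i < j" for i
  proof
    assume "via i = via j"
    then have "stack i = stack j" using via[of i] via[of j] that j by auto
    then show False using inj that j by (auto dest: inj_onD)
  qed
  show "path_inv c stack via t j (c'(via j := leaf c' (via j)))"
    unfolding path_inv_def
  proof (intro conjI allI impI)
    show "centers (c'(via j := leaf c' (via j)))" using centers_flip c' m by blast
    fix i assume "0 < i \<and> i < j"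
    then show "(c'(via j := leaf c' (via j))) (via i) = c (via i)"
      using inv ne[of i] unfolding path_inv_def by auto
  next
    fix v
    show "load (c'(via j := leaf c' (via j))) v + of_bool (v = stack (j - 1)) = load c v + of_bool (v = stack t)"
      using load_flip[OF c'(1) m, of v] c' inv unfolding path_inv_def by (auto dest!: spec[of _ v])
  qed
qed

end

section \<open>Star colorings as choices of centers\<close>

text \<open>
  A maximal node set that contains \<open>r\<close> and spans enough edges is everything: otherwise
  connectivity provides an edge that leaves it, and the outer end of this edge can be added.
\<close>

lemma connected_graph_card_le:
  assumes simple: "simple_graph V E" and conn: "connected_graph V E" and "V \<noteq> {}"
  shows "card V \<le> card E + 1"
proof -
  have finV: "finite V" and edges: "\<And>e. e \<in> E \<Longrightarrow> e \<subseteq> V"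
    using simple by (auto simp: simple_graph_def)
  have finE: "finite E" by (rule finite_subset[of _ "Pow V"]) (use edges finV in auto)
  obtain r where r: "r \<in> V" using assms(3) by blast
  let ?\<S> = "{S. S \<subseteq> V \<and> r \<in> S \<and> card S \<le> card {e \<in> E. e \<subseteq> S} + 1}"
  have "finite ?\<S>" by (rule finite_subset[of _ "Pow V"]) (use finV in auto)
  moreover have "{r} \<in> ?\<S>" using r by simp
  then have "?\<S> \<noteq> {}" by (metis empty_iff)
  ultimately have "\<exists>S\<in>?\<S>. \<forall>S'\<in>?\<S>. S \<subseteq> S' \<longrightarrow> S = S'" by (rule finite_has_maximal)
  then obtain S where S: "S \<in> ?\<S>" and max: "\<forall>S'\<in>?\<S>. S \<subseteq> S' \<longrightarrow> S = S'" by (rule bexE)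
  have "V \<subseteq> S"
  proof
    fix v assume "v \<in> V"
    then have "(r, v) \<in> {(a, b). {a, b} \<in> E}\<^sup>*" using conn r by (simp add: connected_graph_def)
    then show "v \<in> S"
    proof (induction rule: rtrancl_induct)
      case base
      show ?case using S by simp
    next
      case (step a b)
      show ?case
      proof (rule ccontr)
        assume b: "b \<notin> S"
        have ab: "{a, b} \<in> E" using step by simp
        have finS: "finite S" using S finV finite_subset by blast
        have "insert {a, b} {e \<in> E. e \<subseteq> S} \<subseteq> {e \<in> E. e \<subseteq> insert b S}"
          using ab step.IH by auto
        then have "card (insert {a, b} {e \<in> E. e \<subseteq> S}) \<le> card {e \<in> E. e \<subseteq> insert b S}"
          using finE by (intro card_mono) auto
        moreover have "card (insert {a, b} {e \<in> E. e \<subseteq> S}) = card {e \<in> E. e \<subseteq> S} + 1"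
          using finE b by simp
        ultimately have "insert b S \<in> ?\<S>" using S b finS edges[OF ab] by simp
        with max have "S \<subseteq> insert b S \<longrightarrow> S = insert b S" by (rule bspec)
        then show False using b by blast
      qed
    qed
  qed
  then have "V = S" using S by blast
  then have "card V \<le> card {e \<in> E. e \<subseteq> V} + 1" using S by blast
  also have "card {e \<in> E. e \<subseteq> V} \<le> card E" using finE by (intro card_mono) auto
  finally show ?thesis by simp
qed

locale represented_graph =
  fixes V :: "'v set" and E :: "'v set set" and col :: "'v \<Rightarrow> 'c"
    and vs :: "'v list" and es :: "(nat \<times> nat) list" and \<kappa> :: "'v \<Rightarrow> nat"
  assumes simple: "simple_graph V E" and inj_col: "inj_on col V"
    and rep: "represents vs es V E" and nonempty: "V \<noteq> {}"
begin

abbreviation "cap \<equiv> array (map \<kappa> vs)"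

definition edge :: "nat \<Rightarrow> 'v set" where
  "edge i = edge_of vs (es ! i)"

lemma edge_eq: "i < length es \<Longrightarrow> edge i = {vs ! array (map fst es) i, vs ! array (map snd es) i}"
  by (simp add: edge_def edge_of_def array_def)

lemma distinct_vs: "distinct vs" and set_vs: "set vs = V"
  using rep by (auto simp: represents_def)

lemma bij_edge: "bij_betw edge {..<length es} E"
proof -
  have "distinct (map (edge_of vs) es)" "set (map (edge_of vs) es) = E"
    using rep by (auto simp: represents_def)
  then have "bij_betw ((!) (map (edge_of vs) es)) {..<length es} E"
    by (intro bij_betw_nth) auto
  then show ?thesis by (rule bij_betw_cong[THEN iffD1, rotated]) (simp add: edge_def)
qed

lemma card_E: "card E = length es"
  using bij_betw_same_card[OF bij_edge] by simp

lemma E_eq: "E = edge ` {..<length es}"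
  using bij_edge by (simp add: bij_betw_def)

sublocale edge_list "length vs" "length es" "array (map fst es)" "array (map snd es)"
proof
  fix i assume i: "i < length es"
  then have "es ! i \<in> set es" by simp
  then show "array (map fst es) i < length vs" "array (map snd es) i < length vs"
    using rep i by (auto simp: represents_def array_def)
  have "edge i \<in> E" using i E_eq by simp
  then have "card (edge i) = 2" using simple by (simp add: simple_graph_def)
  then show "array (map fst es) i \<noteq> array (map snd es) i"
    using i by (auto simp: edge_eq)
qed

lemma edge_center_leaf:
  assumes "centers c" "i < length es"
  shows "edge i = {vs ! c i, vs ! leaf c i}"
  unfolding edge_eq[OF assms(2)] using leaf_cases[OF assms]
  by (elim disjE conjE) (simp_all only: insert_commute)

text \<open>
  Centers are positions in the list of nodes, and colorings are functions on edges as node sets; this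
  relation translates between the two views.
\<close>

definition realizes :: "('v set \<Rightarrow> 'c) \<Rightarrow> (nat \<Rightarrow> nat) \<Rightarrow> bool" where
  "realizes C c \<longleftrightarrow> centers c \<and> (\<forall>i<length es. C (edge i) = col (vs ! c i))"

lemma realizes_star_coloring: "realizes C c \<Longrightarrow> star_coloring E col C"
  using edge_center_leaf[of c] unfolding realizes_def star_coloring_def E_eq by auto

lemma star_coloring_realizes:
  assumes "star_coloring E col C"
  obtains c where "realizes C c"
proof -
  have "\<exists>x. (x = array (map fst es) i \<or> x = array (map snd es) i) \<and> C (edge i) = col (vs ! x)"
    if "i < length es" for i
    using assms that unfolding star_coloring_def E_eq by (auto simp: edge_eq)
  then obtain c where "\<And>i. i < length es \<Longrightarrow>
      (c i = array (map fst es) i \<or> c i = array (map snd es) i) \<and> C (edge i) = col (vs ! c i)"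
    by metis
  then show thesis by (intro that[of c]) (simp add: realizes_def centers_def)
qed

lemma centers_realized:
  assumes "centers c"
  obtains C where "realizes C c"
proof
  show "realizes (\<lambda>e. col (vs ! c (the_inv_into {..<length es} edge e))) c"
    using assms bij_edge the_inv_into_f_f[of edge "{..<length es}"]
    by (simp add: realizes_def bij_betw_def)
qed

lemma inj_col_nth: "inj_on (\<lambda>i. col (vs ! i)) {..<length vs}"
proof (rule inj_onI)
  fix i j assume ij: "i \<in> {..<length vs}" "j \<in> {..<length vs}" "col (vs ! i) = col (vs ! j)"
  then have "vs ! i = vs ! j" using inj_onD[OF inj_col ij(3)] set_vs nth_mem by auto
  then show "i = j" using ij distinct_vs by (simp add: nth_eq_iff_index_eq)
qed

text \<open>
  The edges with leaf \<open>v\<close> have distinct centers because the graph is simple, so each contributes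
  a color of its own. All edges with center \<open>v\<close> contribute the one remaining color.
\<close>

lemma num_colors_at_eq:
  assumes real: "realizes C c" and v: "v < length vs"
  shows "num_colors_at E C (vs ! v) = load c v + of_bool (load c v < deg v)"
proof -
  have c: "centers c" and C: "\<And>i. i < length es \<Longrightarrow> C (edge i) = col (vs ! c i)"
    using real by (auto simp: realizes_def)
  let ?L = "{i. i < length es \<and> leaf c i = v}"
  let ?M = "{i. i < length es \<and> c i = v}"
  have inc: "vs ! v \<in> edge i \<longleftrightarrow> i \<in> ?L \<union> ?M" if "i < length es" for i
    using that center_less[OF c that] leaf_less[OF c that] v
    by (auto simp: edge_center_leaf[OF c that] nth_eq_iff_index_eq[OF distinct_vs])
  have "{C e | e. e \<in> E \<and> vs ! v \<in> e} = (\<lambda>i. C (edge i)) ` (?L \<union> ?M)"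
    unfolding E_eq using inc by (auto simp: image_iff)
  also have "\<dots> = (\<lambda>i. col (vs ! i)) ` c ` (?L \<union> ?M)"
    using C by (force simp: image_iff)
  finally have "num_colors_at E C (vs ! v) = card ((\<lambda>i. col (vs ! i)) ` c ` (?L \<union> ?M))"
    by (simp add: num_colors_at_def)
  also have "\<dots> = card (c ` (?L \<union> ?M))"
    by (rule card_image, rule inj_on_subset[OF inj_col_nth]) (use center_less[OF c] in auto)
  also have "c ` (?L \<union> ?M) = c ` ?L \<union> c ` ?M" by (rule image_Un)
  also have "card \<dots> = card (c ` ?L) + card (c ` ?M)"
    by (rule card_Un_disjoint) (use leaf_neq_center[OF c] in auto)
  also have "card (c ` ?L) = load c v"
  proof -
    have "i = j" if "i \<in> ?L" "j \<in> ?L" "c i = c j" for i j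
    proof -
      have "edge i = edge j" using that edge_center_leaf[OF c] by simp
      then show ?thesis using bij_edge that by (auto simp: bij_betw_def dest: inj_onD)
    qed
    then show ?thesis unfolding load_def by (intro card_image inj_onI)
  qed
  also have "card (c ` ?M) = of_bool (load c v < deg v)"
  proof (cases "?M = {}")
    case True
    then have "\<not> load c v < deg v" using load_less_deg_iff[OF c] by blast
    then show ?thesis using True by simp
  next
    case False
    then have "load c v < deg v" using load_less_deg_iff[OF c] by blast
    moreover have "c ` ?M = {v}" using False by auto
    ultimately show ?thesis by simp
  qed
  finally show ?thesis .
qed

lemma num_colors_at_le_iff:
  assumes "realizes C c" "v < length vs"
  shows "num_colors_at E C (vs ! v) \<le> l \<longleftrightarrow> load c v < threshold (deg v) l"
proof -
  have "load c v \<le> deg v" using assms(1) load_le_deg by (simp add: realizes_def)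
  then show ?thesis using num_colors_at_eq[OF assms] colors_le_iff_load_less_threshold by simp
qed

lemma all_V: "(\<forall>v\<in>V. P v) \<longleftrightarrow> (\<forall>i<length vs. P (vs ! i))"
  unfolding set_vs[symmetric] by (simp add: all_set_conv_all_nth)

lemma valid_iff_fits:
  assumes "realizes C c"
  shows "valid_star_coloring V E \<kappa> col C \<longleftrightarrow> fits cap c"
  using realizes_star_coloring[OF assms] num_colors_at_le_iff[OF assms]
  unfolding valid_star_coloring_def fits_def all_V by (simp add: array_def)

lemma max_num_colors_le_iff: "max_num_colors V E C \<le> k \<longleftrightarrow> (\<forall>v\<in>V. num_colors_at E C v \<le> k)"
  using simple nonempty unfolding max_num_colors_def by (simp add: simple_graph_def)

lemma valid_max_iff_fits:
  assumes "realizes C c"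
  shows "valid_star_coloring V E \<kappa> col C \<and> max_num_colors V E C \<le> k \<longleftrightarrow> fits (capped cap k) c"
proof -
  have "fits (capped cap k) c \<longleftrightarrow>
      (\<forall>i<length vs. num_colors_at E C (vs ! i) \<le> min (cap i) k)"
    unfolding fits_def using num_colors_at_le_iff[OF assms] by blast
  also have "\<dots> \<longleftrightarrow> (\<forall>v\<in>V. num_colors_at E C v \<le> \<kappa> v) \<and> max_num_colors V E C \<le> k"
    unfolding max_num_colors_le_iff all_V by (auto simp: array_def)
  finally show ?thesis using realizes_star_coloring[OF assms] by (auto simp: valid_star_coloring_def)
qed

lemma feasible_iff_valid: "feasible cap \<longleftrightarrow> (\<exists>C. valid_star_coloring V E \<kappa> col C)"
proof
  assume "feasible cap"
  then obtain c where c: "centers c" "fits cap c" by (auto simp: feasible_def)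
  obtain C where "realizes C c" using centers_realized[OF c(1)] .
  then show "\<exists>C. valid_star_coloring V E \<kappa> col C" using c(2) valid_iff_fits by blast
next
  assume "\<exists>C. valid_star_coloring V E \<kappa> col C"
  then obtain C where C: "valid_star_coloring V E \<kappa> col C" ..
  then obtain c where "realizes C c"
    using star_coloring_realizes[of C] unfolding valid_star_coloring_def by blast
  then show "feasible cap"
    using C valid_iff_fits unfolding feasible_def realizes_def by blast
qed

lemma feasible_min_if_valid:
  assumes "valid_star_coloring V E \<kappa> col C" "max_num_colors V E C \<le> k"
  shows "feasible (capped cap k)"
proof -
  obtain c where "realizes C c"
    using star_coloring_realizes[of C] assms(1) unfolding valid_star_coloring_def by blast
  then show ?thesis
    using assms valid_max_iff_fits[of C c k] unfolding feasible_def realizes_def by blast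
qed

text \<open>
  A better valid coloring would have at most \<open>k - 1\<close> colors at each node, which \<open>minimal\<close> excludes
  for \<open>k > 1\<close>. For \<open>k = 1\<close> it would have no colors at all, so there are no edges.
\<close>

lemma correct_output_if_minimal:
  assumes c: "centers (t ''center'')" and fits: "fits (capped cap k) (t ''center'')"
    and minimal: "k = 1 \<or> \<not> feasible (capped cap (k - 1))" and found: "t ''found'' 0 = 1"
  shows "correct_output V E \<kappa> col vs es t"
proof -
  obtain C where C: "realizes C (t ''center'')" using centers_realized[OF c] .
  have valid: "valid_star_coloring V E \<kappa> col C" and max: "max_num_colors V E C \<le> k"
    using valid_max_iff_fits[OF C] fits by auto
  have opt: "max_num_colors V E C \<le> max_num_colors V E C'"
    if C': "valid_star_coloring V E \<kappa> col C'" for C'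
  proof (rule ccontr)
    assume less: "\<not> ?thesis"
    then have "max_num_colors V E C' \<le> k - 1" using max by simp
    then have "feasible (capped cap (k - 1))" using feasible_min_if_valid C' by blast
    then have k: "k = 1" using minimal by blast
    then have 0: "num_colors_at E C' v = 0" if "v \<in> V" for v
      using less max max_num_colors_le_iff[of C' 0] that by auto
    obtain c' where c': "realizes C' c'"
      using star_coloring_realizes[of C'] C' unfolding valid_star_coloring_def by blast
    have "num_colors_at E C (vs ! i) = 0" if "i < length vs" for i
    proof -
      have "num_colors_at E C' (vs ! i) = 0" using 0 that set_vs by auto
      then have "deg i = 0" using num_colors_at_eq[OF c' that] by (auto split: if_splits)
      then show ?thesis using num_colors_at_eq[OF C that] load_le_deg[OF c, of i] by simp
    qed
    then have "max_num_colors V E C \<le> 0" unfolding max_num_colors_le_iff all_V by simp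
    then show False using less by simp
  qed
  have "opt_num_colors V E \<kappa> col = enat (max_num_colors V E C)"
    unfolding opt_num_colors_def
    by (intro antisym INF_lower2[of C] INF_greatest) (use valid opt in auto)
  moreover have "output_coloring vs es col t C"
    using C center_less[OF c] unfolding output_coloring_def realizes_def edge_def by blast
  ultimately show ?thesis using valid found unfolding correct_output_def by auto
qed

lemma correct_output_if_infeasible:
  assumes "\<not> feasible cap" "t ''found'' 0 = 0"
  shows "correct_output V E \<kappa> col vs es t"
  using assms feasible_iff_valid unfolding correct_output_def by blast

end

section \<open>Weakest preconditions with running times\<close>

text \<open>
  The postcondition \<open>Q\<close> also speaks of the number of steps. Commands are executed symbolically by
  the rules below; the steps accumulate in the argument of \<open>Q\<close>.
\<close>

definition wp :: "com \<Rightarrow> (nat \<Rightarrow> state \<Rightarrow> bool) \<Rightarrow> state \<Rightarrow> bool" where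
  "wp c Q s \<longleftrightarrow> (\<exists>k t. exec c s k t \<and> Q k t)"

lemma wp_Skip: "Q 1 s \<Longrightarrow> wp Skip Q s"
  unfolding wp_def using exec.Skip by blast

lemma wp_Write:
  "Q (1 + acost i + acost a) (s(x := (s x)(aval i s := aval a s))) \<Longrightarrow> wp (Write x i a) Q s"
  unfolding wp_def using exec.Write by blast

lemma wp_Seq: "wp c1 (\<lambda>k s'. wp c2 (\<lambda>k'. Q (k + k')) s') s \<Longrightarrow> wp (Seq c1 c2) Q s"
  unfolding wp_def using exec.Seq by blast

lemma wp_If:
  "(bval b s \<Longrightarrow> wp c1 (\<lambda>k. Q (1 + bcost b + k)) s) \<Longrightarrow>
   (\<not> bval b s \<Longrightarrow> wp c2 (\<lambda>k. Q (1 + bcost b + k)) s) \<Longrightarrow> wp (If b c1 c2) Q s"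
  unfolding wp_def using exec.IfTrue exec.IfFalse by metis

text \<open>
  With this rule, index and value are simplified before they enter the state. Repeated use of
  \<open>wp_Write\<close> instead nests unevaluated expressions and lets the terms grow exponentially.
\<close>

lemma wp_Write_eval:
  "aval i s = i' \<Longrightarrow> aval a s = a' \<Longrightarrow>
   Q (1 + acost i + acost a) (s(x := (s x)(i' := a'))) \<Longrightarrow> wp (Write x i a) Q s"
  using wp_Write by blast

lemma wp_If_true: "bval b s \<Longrightarrow> wp c1 (\<lambda>k. Q (1 + bcost b + k)) s \<Longrightarrow> wp (If b c1 c2) Q s"
  by (rule wp_If) auto

lemma wp_If_false: "\<not> bval b s \<Longrightarrow> wp c2 (\<lambda>k. Q (1 + bcost b + k)) s \<Longrightarrow> wp (If b c1 c2) Q s"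
  by (rule wp_If) auto

lemma wp_mono: "wp c Q s \<Longrightarrow> (\<And>k t. Q k t \<Longrightarrow> Q' k t) \<Longrightarrow> wp c Q' s"
  unfolding wp_def by blast

primrec writes :: "com \<Rightarrow> vname set" where
  "writes Skip = {}"
| "writes (Write x i a) = {x}"
| "writes (Seq c1 c2) = writes c1 \<union> writes c2"
| "writes (If b c1 c2) = writes c1 \<union> writes c2"
| "writes (While b c) = writes c"

text \<open>
  Thanks to this, specifications of commands only have to describe what is written.
\<close>

lemma exec_frame: "exec c s k t \<Longrightarrow> x \<notin> writes c \<Longrightarrow> t x = s x"
  by (induction rule: exec.induct) auto

lemma wp_frame:
  assumes "wp c Q s" "\<And>k t. Q k t \<Longrightarrow> (\<And>x. x \<notin> writes c \<Longrightarrow> t x = s x) \<Longrightarrow> Q' k t"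
  shows "wp c Q' s"
  using assms exec_frame unfolding wp_def by metis

text \<open>
  The invariant is indexed by a bound \<open>j\<close> on the number of remaining iterations. In the body, all
  arrays that the loop does not write may be assumed to have their initial contents.
\<close>

lemma wp_While:
  fixes I :: "nat \<Rightarrow> state \<Rightarrow> bool"
  assumes body: "\<And>j s. I j s \<Longrightarrow> bval b s \<Longrightarrow> (\<And>x. x \<notin> writes c \<Longrightarrow> s x = s0 x) \<Longrightarrow>
      wp c (\<lambda>k t. k \<le> B \<and> (\<exists>j'<j. I j' t)) s"
    and init: "I j s0"
  shows "wp (While b c) (\<lambda>k t. k \<le> (j + 1) * (1 + bcost b + B) \<and> (\<exists>j'\<le>j. I j' t) \<and> \<not> bval b t) s0"
proof -
  have "wp (While b c) (\<lambda>k t. k \<le> (j + 1) * (1 + bcost b + B) \<and> (\<exists>j'\<le>j. I j' t) \<and> \<not> bval b t) s"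
    if "I j s" "\<And>x. x \<notin> writes c \<Longrightarrow> s x = s0 x" for s
    using that
  proof (induction j arbitrary: s rule: less_induct)
    case (less j)
    show ?case
    proof (cases "bval b s")
      case False
      have "exec (While b c) s (1 + bcost b) s" using False by (rule exec.WhileFalse)
      then show ?thesis using less.prems(1) False unfolding wp_def by (force simp: algebra_simps)
    next
      case True
      obtain k t j' where 1: "exec c s k t" "k \<le> B" "j' < j" "I j' t"
        using body[OF less.prems(1) True less.prems(2)] unfolding wp_def by blast
      have "t x = s0 x" if "x \<notin> writes c" for x
        using exec_frame[OF 1(1) that] less.prems(2)[OF that] by simp
      then obtain k' t' j'' where 2: "exec (While b c) t k' t'"
        "k' \<le> (j' + 1) * (1 + bcost b + B)" "j'' \<le> j'" "I j'' t'" "\<not> bval b t'"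
        using less.IH[OF 1(3,4)] unfolding wp_def by blast
      have "(j' + 1) * (1 + bcost b + B) \<le> j * (1 + bcost b + B)"
        using 1(3) by (intro mult_le_mono1) simp
      then have "1 + bcost b + k + k' \<le> (j + 1) * (1 + bcost b + B)"
        using 1(2) 2(2) by (simp add: algebra_simps)
      moreover have "exec (While b c) s (1 + bcost b + k + k') t'"
        using True 1(1) 2(1) by (rule exec.WhileTrue)
      moreover have "j'' \<le> j" using 1(3) 2(3) by simp
      ultimately show ?thesis using 2(4,5) unfolding wp_def by blast
    qed
  qed
  then show ?thesis using init by blast
qed

abbreviation "var x \<equiv> Read x (N 0)"
abbreviation "setv x a \<equiv> Write x (N 0) a"

definition for_less :: "vname \<Rightarrow> com \<Rightarrow> com" where
  "for_less y c = Seq (setv ''i'' (N 0))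
     (While (Less (var ''i'') (var y)) (Seq c (setv ''i'' (Add (var ''i'') (N 1)))))"

lemma writes_for_less [simp]: "writes (for_less y c) = insert ''i'' (writes c)"
  by (auto simp: for_less_def)

text \<open>
  The loop changes its counter after each execution of the body, which \<open>indep\<close> makes harmless: the
  invariant refers to the counter only through its first argument.
\<close>

lemma wp_for_less:
  assumes body: "\<And>i s. i < b \<Longrightarrow> I i s \<Longrightarrow> s ''i'' 0 = i \<Longrightarrow>
      (\<And>x. x \<notin> insert ''i'' (writes c) \<Longrightarrow> s x = s0 x) \<Longrightarrow>
      wp c (\<lambda>k t. k \<le> B \<and> I (Suc i) t) s"
    and init: "I 0 s0" and b: "s0 y 0 = b"
    and indep: "\<And>i s f. I i s \<Longrightarrow> I i (s(''i'' := f))"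
    and nw: "''i'' \<notin> writes c" "y \<notin> writes c" "y \<noteq> ''i''"
  shows "wp (for_less y c) (\<lambda>k t. k \<le> (b + 1) * (B + 20) \<and> I b t) s0"
proof -
  let ?J = "\<lambda>j s. j = b - s ''i'' 0 \<and> s ''i'' 0 \<le> b \<and> I (s ''i'' 0) s"
  let ?c = "Seq c (setv ''i'' (Add (var ''i'') (N 1)))"
  let ?b = "Less (var ''i'') (var y)"
  let ?s = "s0(''i'' := (s0 ''i'')(0 := 0))"
  have W: "wp (While ?b ?c) (\<lambda>k t. k \<le> (b + 1) * (1 + bcost ?b + (B + 6)) \<and>
      (\<exists>j'\<le>b. ?J j' t) \<and> \<not> bval ?b t) ?s"
  proof (rule wp_While[where I = ?J])
    show "?J b ?s" using init indep[OF init] by simp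
    fix j s assume J: "?J j s" and bv: "bval ?b s" and fr: "\<And>x. x \<notin> writes ?c \<Longrightarrow> s x = ?s x"
    have fr': "s x = s0 x" if "x \<notin> insert ''i'' (writes c)" for x
      using fr[of x] that by simp
    have y: "s y 0 = b" using fr'[of y] nw b by simp
    then have lt: "s ''i'' 0 < b" using bv by simp
    have "wp c (\<lambda>k t. k \<le> B \<and> I (Suc (s ''i'' 0)) t) s" using body lt J fr' by blast
    then have "wp c (\<lambda>k t. k \<le> B \<and> I (Suc (s ''i'' 0)) t \<and> t ''i'' = s ''i'') s"
      by (rule wp_frame) (use nw in auto)
    then show "wp ?c (\<lambda>k t. k \<le> B + 6 \<and> (\<exists>j'<j. ?J j' t)) s"
      by (intro wp_Seq, elim wp_mono, intro wp_Write) (use J lt indep in auto)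
  qed
  have "wp (While ?b ?c) (\<lambda>k t. k \<le> (b + 1) * (1 + bcost ?b + (B + 6)) \<and> I b t) ?s"
    by (rule wp_frame[OF W]) (use nw b in \<open>auto dest: le_antisym\<close>)
  then show ?thesis unfolding for_less_def
    by (intro wp_Seq wp_Write, simp only: aval.simps, elim wp_mono) (auto simp: algebra_simps)
qed

section \<open>The program\<close>

abbreviation "incr x i \<equiv> Write x i (Add (Read x i) (N 1))"

definition leaf_exp :: "aexp \<Rightarrow> aexp" where
  "leaf_exp e = Sub (Add (Read ''src'' e) (Read ''dst'' e)) (Read ''center'' e)"

text \<open>
  The initial centers are arbitrary; the second component of each edge is as good as any other
  choice.
\<close>

definition count_edge :: com where
  "count_edge =
     Seq (incr ''deg'' (Read ''src'' (var ''i'')))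
       (Seq (incr ''deg'' (Read ''dst'' (var ''i'')))
            (Write ''center'' (var ''i'') (Read ''dst'' (var ''i''))))"

definition initialize :: com where
  "initialize =
     Seq (for_less ''m'' count_edge)
     (setv ''k'' (N 1))"

definition reset_node :: com where
  "reset_node =
     Seq (setv ''limit'' (Read ''cap'' (var ''i'')))
     (Seq (If (Less (var ''k'') (var ''limit'')) (setv ''limit'' (var ''k'')) Skip)
     (Seq (If (Less (var ''limit'') (Read ''deg'' (var ''i'')))
            (Write ''threshold'' (var ''i'') (var ''limit''))
            (Write ''threshold'' (var ''i'') (Add (Read ''deg'' (var ''i'')) (N 1))))
     (Seq (Write ''load'' (var ''i'') (N 0))
     (Seq (Write ''first'' (var ''i'') (N 0))
          (Write ''mark'' (var ''i'') (N 0))))))"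

definition reset_nodes :: com where
  "reset_nodes = for_less ''n'' reset_node"

definition link_edge :: com where
  "link_edge =
     Seq (setv ''v'' (leaf_exp (var ''i'')))
     (Seq (incr ''load'' (var ''v''))
     (Seq (Write ''next'' (var ''i'') (Read ''first'' (var ''v'')))
          (Write ''first'' (var ''v'') (Add (var ''i'') (N 1)))))"

definition link_edges :: com where
  "link_edges = for_less ''m'' link_edge"

definition test_node :: com where
  "test_node =
     If (Less (Read ''load'' (var ''i'')) (Read ''threshold'' (var ''i'')))
          Skip (setv ''r'' (var ''i''))"

definition find_overloaded :: com where
  "find_overloaded =
     Seq (setv ''r'' (var ''n''))
     (for_less ''n'' test_node)"

text \<open>
  The stack has height \<open>h\<close>; \<open>hit\<close> is set when the node on top of it has room.
\<close>

definition search_step :: com where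
  "search_step =
     Seq (setv ''v'' (Read ''stack'' (Sub (var ''h'') (N 1))))
     (If (Less (Add (Read ''load'' (var ''v'')) (N 1)) (Read ''threshold'' (var ''v'')))
        (setv ''hit'' (N 1))
     (If (Eq (Read ''first'' (var ''v'')) (N 0))
        (setv ''h'' (Sub (var ''h'') (N 1)))
     (Seq (setv ''e'' (Sub (Read ''first'' (var ''v'')) (N 1)))
     (Seq (Write ''first'' (var ''v'') (Read ''next'' (var ''e'')))
     (Seq (setv ''u'' (Read ''center'' (var ''e'')))
     (If (Eq (Read ''mark'' (var ''u'')) (N 0))
       (Seq (Write ''mark'' (var ''u'') (N 1))
       (Seq (Write ''stack'' (var ''h'') (var ''u''))
       (Seq (Write ''via'' (var ''h'') (var ''e''))
            (setv ''h'' (Add (var ''h'') (N 1))))))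
       Skip))))))"

definition search :: com where
  "search =
     Seq (Write ''stack'' (N 0) (var ''r''))
     (Seq (setv ''h'' (N 1))
     (Seq (Write ''mark'' (var ''r'') (N 1))
     (Seq (setv ''hit'' (N 0))
     (While (And (Less (N 0) (var ''h'')) (Eq (var ''hit'') (N 0))) search_step))))"

definition flip_path :: com where
  "flip_path =
     While (Less (N 1) (var ''h''))
       (Seq (setv ''h'' (Sub (var ''h'') (N 1)))
       (Seq (setv ''e'' (Read ''via'' (var ''h'')))
            (Write ''center'' (var ''e'') (leaf_exp (var ''e'')))))"

text \<open>
  A round recomputes loads, thresholds and lists of edges from scratch, which is within the bound
  \<open>O(m + n)\<close> for the search. Once \<open>k\<close> has reached \<open>m\<close> it is at least every degree, and raising it
  further would leave the thresholds unchanged.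
\<close>

definition round :: com where
  "round =
     Seq reset_nodes (Seq link_edges (Seq find_overloaded
     (If (Eq (var ''r'') (var ''n''))
        (Seq (setv ''found'' (N 1)) (setv ''done'' (N 1)))
     (Seq search
     (If (Eq (var ''hit'') (N 1)) flip_path
     (If (Less (var ''k'') (var ''m''))
        (setv ''k'' (Add (var ''k'') (N 1)))
        (setv ''done'' (N 1))))))))"

definition min_star_coloring :: com where
  "min_star_coloring = Seq initialize (While (Eq (var ''done'') (N 0)) round)"

section \<open>Initialization and preparation of a round\<close>

lemma writes_program [simp]:
  "writes count_edge = {''deg'', ''center''}"
  "writes reset_node = {''limit'', ''threshold'', ''load'', ''first'', ''mark''}"
  "writes link_edge = {''v'', ''load'', ''next'', ''first''}"
  "writes test_node = {''r''}"
  "writes search_step = {''v'', ''hit'', ''h'', ''e'', ''first'', ''u'', ''mark'', ''stack'', ''via''}"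
  "writes flip_path = {''h'', ''e'', ''center''}"
  by (auto simp: count_edge_def reset_node_def link_edge_def test_node_def search_step_def flip_path_def)

lemma writes_program' [simp]:
  "writes initialize = {''i'', ''deg'', ''center'', ''k''}"
  "writes reset_nodes = {''i'', ''limit'', ''threshold'', ''load'', ''first'', ''mark''}"
  "writes link_edges = {''i'', ''v'', ''load'', ''next'', ''first''}"
  "writes find_overloaded = {''i'', ''r''}"
  "writes search = {''v'', ''hit'', ''h'', ''e'', ''first'', ''u'', ''mark'', ''stack'', ''via''}"
  by (auto simp: initialize_def reset_nodes_def link_edges_def find_overloaded_def search_def)

lemmas wp_straight = wp_Seq wp_Write wp_If wp_Skip

context edge_list
begin

definition inputs :: "(nat \<Rightarrow> nat) \<Rightarrow> state \<Rightarrow> bool" where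
  "inputs cap s \<longleftrightarrow> s ''n'' 0 = n \<and> s ''m'' 0 = m \<and> s ''src'' = src \<and> s ''dst'' = dst \<and> s ''cap'' = cap"

text \<open>
  The numeric constants in this and the following bounds are generous; only linearity matters.
\<close>

lemma wp_initialize:
  assumes "inputs cap s0" "s0 ''deg'' = (\<lambda>_. 0)"
  shows "wp initialize (\<lambda>k t. k \<le> (m + 1) * 60 \<and> t ''k'' 0 = 1 \<and>
      t ''deg'' = deg \<and> centers (t ''center'')) s0"
proof -
  let ?I = "\<lambda>i s. s ''deg'' = (\<lambda>v. card {j. j < i \<and> (src j = v \<or> dst j = v)}) \<and> (\<forall>j<i. s ''center'' j = dst j)"
  show ?thesis
    unfolding initialize_def
  proof (rule wp_Seq, rule wp_mono, rule wp_for_less[where I = ?I and B = 30 and b = m])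
    fix i s assume i: "i < m" and I: "?I i s" and s: "s ''i'' 0 = i"
      and fr: "\<And>x. x \<notin> insert ''i'' (writes count_edge) \<Longrightarrow> s x = s0 x"
    have in_s: "s ''src'' = src" "s ''dst'' = dst" using fr assms(1) by (simp_all add: inputs_def)
    have d: "(\<lambda>v. card {j. j < Suc i \<and> (src j = v \<or> dst j = v)}) =
      (s ''deg'')(src i := Suc (s ''deg'' (src i)), dst i := Suc (s ''deg'' (dst i)))"
      using I no_loop[OF i] by (auto simp: deg_prefix_Suc[OF i])
    show "wp count_edge (\<lambda>k t. k \<le> 30 \<and> ?I (Suc i) t) s"
      unfolding d by (unfold count_edge_def, intro wp_straight) (use I s in_s no_loop[OF i] in \<open>auto simp: less_Suc_eq\<close>)
  next
    fix k t assume "k \<le> (m + 1) * (30 + 20) \<and> ?I m t"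
    then show "wp (setv ''k'' (N 1)) (\<lambda>k'. (\<lambda>k t. k \<le> (m + 1) * 60 \<and> t ''k'' 0 = 1 \<and>
      t ''deg'' = deg \<and> centers (t ''center'')) (k + k')) t"
      by (intro wp_straight) (auto simp: deg_def fun_eq_iff centers_def)
  qed (use assms in \<open>auto simp: inputs_def\<close>)
qed

lemma wp_reset_nodes:
  assumes "inputs cap s0" "s0 ''deg'' = deg"
  shows "wp reset_nodes (\<lambda>k t. k \<le> (n + 1) * 100 \<and>
     (\<forall>v<n. t ''threshold'' v = threshold (deg v) (capped cap (s0 ''k'' 0) v) \<and>
        t ''load'' v = 0 \<and> t ''first'' v = 0 \<and> t ''mark'' v = 0)) s0"
  (is "wp _ (\<lambda>k t. _ \<and> ?I n t) _")
proof -
  show ?thesis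
    unfolding reset_nodes_def
  proof (rule wp_mono, rule wp_for_less[where I = ?I and B = 70 and b = n])
    fix i s assume i: "i < n" and I: "?I i s" and s: "s ''i'' 0 = i"
      and fr: "\<And>x. x \<notin> insert ''i'' (writes reset_node) \<Longrightarrow> s x = s0 x"
    have in_s: "s ''cap'' = cap" "s ''deg'' = deg" "s ''k'' = s0 ''k''"
      using fr assms by (simp_all add: inputs_def)
    show "wp reset_node (\<lambda>k t. k \<le> 70 \<and> ?I (Suc i) t) s"
      by (unfold reset_node_def, intro wp_straight) (use I s in_s in \<open>auto simp: less_Suc_eq threshold_def min_def\<close>)
  qed (use assms in \<open>auto simp: inputs_def\<close>)
qed

lemma wp_link_edges:
  assumes "inputs cap s0" "centers (s0 ''center'')"
    and "\<forall>v<n. s0 ''load'' v = 0 \<and> s0 ''first'' v = 0"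
  shows "wp link_edges (\<lambda>k t. k \<le> (m + 1) * 100 \<and>
     (\<forall>v<n. t ''load'' v = load (s0 ''center'') v) \<and>
     linked (s0 ''center'') m (t ''first'') (t ''next'')) s0"
proof -
  let ?c = "s0 ''center''"
  let ?I = "\<lambda>i s. (\<forall>v<n. s ''load'' v = card {j. j < i \<and> leaf ?c j = v}) \<and>
     linked ?c i (s ''first'') (s ''next'')"
  show ?thesis
    unfolding link_edges_def
  proof (rule wp_mono, rule wp_for_less[where I = ?I and B = 50 and b = m])
    fix i s assume i: "i < m" and I: "?I i s" and s: "s ''i'' 0 = i"
      and fr: "\<And>x. x \<notin> insert ''i'' (writes link_edge) \<Longrightarrow> s x = s0 x"
    have in_s: "s ''src'' i + s ''dst'' i - s ''center'' i = leaf ?c i"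
      using fr assms by (simp add: inputs_def leaf_def)
    show "wp link_edge (\<lambda>k t. k \<le> 50 \<and> ?I (Suc i) t) s"
      by (unfold link_edge_def, intro wp_straight)
        (use I s in_s linked_Suc[OF conjunct2[OF I] assms(2) i] in
          \<open>simp add: leaf_exp_def load_prefix_Suc\<close>)
  qed (use assms in \<open>auto simp: inputs_def load_def linked_def\<close>)
qed

lemma wp_find_overloaded:
  assumes "inputs cap s0"
  shows "wp find_overloaded (\<lambda>k t. k \<le> (n + 1) * 60 \<and>
     (if t ''r'' 0 = n then \<forall>v<n. s0 ''load'' v < s0 ''threshold'' v
      else t ''r'' 0 < n \<and> s0 ''threshold'' (t ''r'' 0) \<le> s0 ''load'' (t ''r'' 0))) s0"
proof -
  let ?I = "\<lambda>i t. if t ''r'' 0 = n then \<forall>v<i. s0 ''load'' v < s0 ''threshold'' v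
      else t ''r'' 0 < n \<and> s0 ''threshold'' (t ''r'' 0) \<le> s0 ''load'' (t ''r'' 0)"
  let ?s = "s0(''r'' := (s0 ''r'')(0 := n))"
  have "wp (for_less ''n'' test_node) (\<lambda>k t. k \<le> (n + 1) * (20 + 20) \<and> ?I n t) ?s"
  proof (rule wp_for_less[where I = ?I])
    fix i s assume i: "i < n" and I: "?I i s" and s: "s ''i'' 0 = i"
      and fr: "\<And>x. x \<notin> insert ''i'' (writes test_node) \<Longrightarrow> s x = ?s x"
    have in_s: "s ''load'' = s0 ''load''" "s ''threshold'' = s0 ''threshold''"
      using fr by simp_all
    show "wp test_node (\<lambda>k t. k \<le> 20 \<and> ?I (Suc i) t) s"
      by (unfold test_node_def, intro wp_straight) (use I i s in_s in \<open>auto simp: less_Suc_eq split: if_splits\<close>)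
  qed (use assms in \<open>auto simp: inputs_def\<close>)
  moreover have n: "s0 ''n'' 0 = n" using assms by (simp add: inputs_def)
  ultimately show ?thesis unfolding find_overloaded_def
    by (intro wp_Seq wp_Write, unfold aval.simps n, elim wp_mono) (auto split: if_splits)
qed

end

section \<open>Search and exchange\<close>

context edge_list
begin

text \<open>
  The bound \<open>j\<close> on the number of remaining iterations decreases with each of them: a scanned edge counts
  twice, which pays for the node that it may push onto the stack.
\<close>

definition search_inv where
  "search_inv c full j s \<longleftrightarrow>
     dfs_inv c full (s ''r'' 0) (s ''first'') (s ''mark'') (s ''stack'') (s ''via'') (s ''h'' 0) \<and>
     (s ''hit'' 0 = 0 \<or> s ''hit'' 0 = 1 \<and> 0 < s ''h'' 0 \<and> \<not> full (s ''stack'' (s ''h'' 0 - 1))) \<and>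
     j = 2 * unscanned c (s ''first'') + s ''h'' 0 + (1 - s ''hit'' 0)"

lemma wp_search_step:
  assumes c: "centers (s ''center'')" and l: "linked (s ''center'') m first0 (s ''next'')"
    and full: "full = (\<lambda>v. s ''threshold'' v \<le> s ''load'' v + 1)"
    and inv: "search_inv (s ''center'') full j s" and h: "0 < s ''h'' 0" "s ''hit'' 0 = 0"
  shows "wp search_step (\<lambda>k t. k \<le> 100 \<and> (\<exists>j'<j. search_inv (s ''center'') full j' t)) s"
proof -
  let ?c = "s ''center''"
  obtain t where t: "s ''h'' 0 = Suc t" using h(1) gr0_implies_Suc by blast
  define v where "v = s ''stack'' t"
  have d: "dfs_inv ?c full (s ''r'' 0) (s ''first'') (s ''mark'') (s ''stack'') (s ''via'') (Suc t)"
    and j: "j = 2 * unscanned ?c (s ''first'') + Suc t + 1"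
    using inv t h unfolding search_inv_def by simp_all
  consider (hit) "\<not> full v" | (pop) "full v" "s ''first'' v = 0" | (scan) "full v" "s ''first'' v \<noteq> 0"
    by blast
  then show ?thesis
  proof cases
    case hit
    then have "s ''load'' v + 1 < s ''threshold'' v" unfolding full by simp
    note F = this hit d
      show ?thesis unfolding search_step_def
      by (insert F, (rule wp_Seq | (rule wp_Write_eval, (simp add: t v_def[symmetric]; fail), (simp add: t v_def[symmetric]; fail)) | (rule wp_If_true, (simp add: t v_def[symmetric]; fail)) | (rule wp_If_false, (simp add: t v_def[symmetric]; fail)) | rule wp_Skip)+)
        (simp add: search_inv_def t j v_def[symmetric])
  next
    case pop
    have nf: "\<not> s ''load'' v + 1 < s ''threshold'' v" using pop(1) unfolding full by simp
    have "dfs_inv ?c full (s ''r'' 0) (s ''first'') (s ''mark'') (s ''stack'') (s ''via'') t"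
      using dfs_pop[OF d] pop by (simp add: v_def)
    note F = this nf pop
      show ?thesis unfolding search_step_def
      by (insert F, (rule wp_Seq | (rule wp_Write_eval, (simp add: t v_def[symmetric]; fail), (simp add: t v_def[symmetric]; fail)) | (rule wp_If_true, (simp add: t v_def[symmetric]; fail)) | (rule wp_If_false, (simp add: t v_def[symmetric]; fail)) | rule wp_Skip)+)
        (simp add: search_inv_def t h j v_def[symmetric])
  next
    case scan
    have nf: "\<not> s ''load'' v + 1 < s ''threshold'' v" using scan(1) unfolding full by simp
    obtain e where e: "s ''first'' v = Suc e" "e < m" "leaf ?c e = v" "v < n"
      using dfs_edge[OF d] scan unfolding v_def by blast
    define first' where "first' = (s ''first'')(v := s ''next'' e)"
    have less: "unscanned ?c first' < unscanned ?c (s ''first'')"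
      unfolding first'_def by (rule unscanned_next[where nxt = "s ''next''" and first = "s ''first''", OF c l e(4,1,2,3)])
    show ?thesis
    proof (cases "s ''mark'' (?c e) = 0")
      case False
      have on: "v \<in> s ''stack'' ` {..<Suc t}" unfolding v_def by simp
      have "dfs_inv ?c full (s ''r'' 0) first' (s ''mark'') (s ''stack'') (s ''via'') (Suc t)"
        unfolding first'_def using dfs_scan[OF c l d on e(1,2,3) False] by simp
      note F = this nf e(1) False less
        show ?thesis unfolding search_step_def
        by (insert F, (rule wp_Seq | (rule wp_Write_eval, (simp add: t v_def[symmetric]; fail), (simp add: t v_def[symmetric]; fail)) | (rule wp_If_true, (simp add: t v_def[symmetric]; fail)) | (rule wp_If_false, (simp add: t v_def[symmetric]; fail)) | rule wp_Skip)+)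
          (simp add: search_inv_def t h j first'_def[symmetric])
    next
      case True
      let ?mark = "(s ''mark'')(?c e := 1)"
      have on: "v \<in> ((s ''stack'')(Suc t := ?c e)) ` {..<Suc (Suc t)}"
        unfolding v_def by (rule image_eqI[of _ _ t]) simp_all
      have m: "dfs_inv ?c full (s ''r'' 0) (s ''first'') ?mark
          ((s ''stack'')(Suc t := ?c e)) ((s ''via'')(Suc t := e)) (Suc (Suc t))"
        using dfs_mark[OF c d e(2) _ True] e(3) by (simp add: v_def)
      have "dfs_inv ?c full (s ''r'' 0) first' ?mark
          ((s ''stack'')(Suc t := ?c e)) ((s ''via'')(Suc t := e)) (Suc (Suc t))"
        unfolding first'_def using dfs_scan[OF c l m on e(1,2,3)] by simp
      note F = this nf e(1) True less
        show ?thesis unfolding search_step_def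
        by (insert F, (rule wp_Seq | (rule wp_Write_eval, (simp add: t v_def[symmetric]; fail), (simp add: t v_def[symmetric]; fail)) | (rule wp_If_true, (simp add: t v_def[symmetric]; fail)) | (rule wp_If_false, (simp add: t v_def[symmetric]; fail)) | rule wp_Skip)+)
          (simp add: search_inv_def t h j first'_def[symmetric])
    qed
  qed
qed

lemma wp_search:
  assumes c: "centers (s ''center'')" and l: "linked (s ''center'') m (s ''first'') (s ''next'')"
    and r: "s ''r'' 0 < n" and mark: "\<forall>v<n. s ''mark'' v = 0"
    and full: "full = (\<lambda>v. s ''threshold'' v \<le> s ''load'' v + 1)"
  shows "wp search (\<lambda>k t. k \<le> 500 * (m + 1) \<and> (\<exists>j. search_inv (s ''center'') full j t) \<and>
      (t ''h'' 0 = 0 \<or> t ''hit'' 0 = 1)) s"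
proof -
  let ?c = "s ''center''"
  let ?j = "2 * unscanned ?c (s ''first'') + 2"
  let ?b = "And (Less (N 0) (var ''h'')) (Eq (var ''hit'') (N 0))"
  have W: "wp (While ?b search_step) (\<lambda>k t. k \<le> (?j + 1) * (1 + bcost ?b + 100) \<and>
      (\<exists>j'\<le>?j. search_inv ?c full j' t) \<and> \<not> bval ?b t) s1"
    if s1: "s1 ''stack'' = (s ''stack'')(0 := s ''r'' 0)" "s1 ''h'' 0 = 1" "s1 ''hit'' 0 = 0"
      "s1 ''mark'' = (s ''mark'')(s ''r'' 0 := 1)"
      and s1_same: "\<And>x. x \<notin> {''stack'', ''h'', ''hit'', ''mark''} \<Longrightarrow> s1 x = s x" for s1
  proof (rule wp_While[where I = "search_inv ?c full"])
    show "search_inv ?c full ?j s1"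
      using dfs_init[OF r l mark, of full "s ''stack''" "s ''via''"]
      unfolding search_inv_def by (simp add: s1 s1_same)
    fix j' s' assume inv: "search_inv ?c full j' s'" and b: "bval ?b s'"
      and fr: "\<And>x. x \<notin> writes search_step \<Longrightarrow> s' x = s1 x"
    have same: "s' ''center'' = ?c" "s' ''next'' = s ''next''" "s' ''threshold'' = s ''threshold''"
      "s' ''load'' = s ''load''" using fr by (simp_all add: s1_same)
    show "wp search_step (\<lambda>k t. k \<le> 100 \<and> (\<exists>j<j'. search_inv ?c full j t)) s'"
      using wp_search_step[of s' "s ''first''" full j'] c l full inv b unfolding same by simp
  qed
  have cost: "(?j + 1) * (1 + bcost ?b + 100) + 20 \<le> 500 * (m + 1)"
    using unscanned_le[of ?c "s ''first''"] by simp
  show ?thesis unfolding search_def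
  proof (rule wp_Seq, rule wp_Write, rule wp_Seq, rule wp_Write, rule wp_Seq, rule wp_Write,
      rule wp_Seq, rule wp_Write, rule wp_mono, rule W)
    fix k t
    assume "k \<le> (?j + 1) * (1 + bcost ?b + 100) \<and> (\<exists>j'\<le>?j. search_inv ?c full j' t) \<and> \<not> bval ?b t"
    then show "1 + acost (N 0) + acost (var ''r'') + (1 + acost (N 0) + acost (N 1) +
         (1 + acost (var ''r'') + acost (N 1) + (1 + acost (N 0) + acost (N 0) + k))) \<le> 500 * (m + 1) \<and>
      (\<exists>j. search_inv ?c full j t) \<and> (t ''h'' 0 = 0 \<or> t ''hit'' 0 = 1)"
      using cost by (auto simp: search_inv_def)
  qed simp_all
qed

lemma wp_flip_path:
  assumes inputs: "inputs cap s" and c: "centers (s ''center'')"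
    and dfs: "dfs_inv (s ''center'') full r first mark (s ''stack'') (s ''via'') (s ''h'' 0)"
    and h: "s ''h'' 0 = Suc t0"
  shows "wp flip_path (\<lambda>k t. k \<le> 60 * (n + 2) \<and> centers (t ''center'') \<and>
     (\<forall>v. load (t ''center'') v + of_bool (v = r) =
          load (s ''center'') v + of_bool (v = s ''stack'' t0))) s"
proof -
  let ?c = "s ''center''"
  let ?I = "\<lambda>j t. j = t ''h'' 0 \<and> 0 < j \<and> j \<le> Suc t0 \<and>
      path_inv ?c (s ''stack'') (s ''via'') t0 j (t ''center'')"
  let ?b = "Less (N 1) (var ''h'')"
  let ?body = "Seq (setv ''h'' (Sub (var ''h'') (N 1)))
       (Seq (setv ''e'' (Read ''via'' (var ''h'')))
            (Write ''center'' (var ''e'') (leaf_exp (var ''e''))))"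
  note dfs' = dfs[unfolded h]
  have "wp (While ?b ?body) (\<lambda>k t. k \<le> (Suc t0 + 1) * (1 + bcost ?b + 50) \<and>
      (\<exists>j'\<le>Suc t0. ?I j' t) \<and> \<not> bval ?b t) s"
  proof (rule wp_While[where I = ?I])
    show "?I (Suc t0) s" using h c by (simp add: path_inv_def)
    fix j t assume I: "?I j t" and b: "bval ?b t"
      and fr: "\<And>x. x \<notin> writes ?body \<Longrightarrow> t x = s x"
    have same: "t ''src'' = src" "t ''dst'' = dst" "t ''via'' = s ''via''"
      using fr inputs by (simp_all add: inputs_def)
    obtain i where i: "t ''h'' 0 = Suc i" "0 < i" using b by (cases "t ''h'' 0") auto
    define e where "e = s ''via'' i"
    have j: "j = Suc i" "i \<le> t0" using I i by auto
    have p: "path_inv ?c (s ''stack'') (s ''via'') t0 (Suc i) (t ''center'')"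
      using I unfolding j(1) by blast
    have step: "path_inv ?c (s ''stack'') (s ''via'') t0 i ((t ''center'')(e := leaf (t ''center'') e))"
      unfolding e_def by (rule path_step[OF dfs' p i(2) j(2)])
    show "wp ?body (\<lambda>k t. k \<le> 50 \<and> (\<exists>j'<j. ?I j' t)) t"
      by ((rule wp_Seq | (rule wp_Write_eval, (simp add: i same e_def[symmetric]; fail),
           (simp add: i same e_def[symmetric] leaf_exp_def; fail)))+)
        (use i j step in \<open>simp add: leaf_def leaf_exp_def\<close>)
  qed
  then show ?thesis
    unfolding flip_path_def
  proof (rule wp_mono)
    fix k t
    assume *: "k \<le> (Suc t0 + 1) * (1 + bcost ?b + 50) \<and> (\<exists>j'\<le>Suc t0. ?I j' t) \<and> \<not> bval ?b t"
    then obtain j where j: "?I j t" by blast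
    have "j = 1" using * j by simp
    then have p: "path_inv ?c (s ''stack'') (s ''via'') t0 1 (t ''center'')" using j by blast
    have "s ''stack'' 0 = r" using dfs' dfs_invD(2) by blast
    moreover have "Suc t0 \<le> n" using dfs_height[OF dfs'] .
    ultimately show "k \<le> 60 * (n + 2) \<and> centers (t ''center'') \<and>
     (\<forall>v. load (t ''center'') v + of_bool (v = r) = load ?c v + of_bool (v = s ''stack'' t0))"
      using * p by (simp add: path_inv_def)
  qed
qed

section \<open>Rounds\<close>

text \<open>
  The bound \<open>j\<close> on the number of remaining rounds drops because a round decreases the excess,
  raises \<open>k\<close> without increasing the excess, or ends the computation.
\<close>

definition round_inv :: "(nat \<Rightarrow> nat) \<Rightarrow> nat \<Rightarrow> state \<Rightarrow> bool" where
  "round_inv cap j s \<longleftrightarrow> inputs cap s \<and> s ''deg'' = deg \<and> centers (s ''center'') \<and>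
     (s ''k'' 0 = 1 \<or> \<not> feasible (capped cap (s ''k'' 0 - 1))) \<and>
     (s ''done'' 0 = 0 \<and> s ''found'' 0 = 0 \<and>
        j = excess (capped cap (s ''k'' 0)) (s ''center'') + (m - s ''k'' 0) + 1 \<or>
      s ''done'' 0 = 1 \<and> s ''found'' 0 = 1 \<and> fits (capped cap (s ''k'' 0)) (s ''center'') \<and> j = 0 \<or>
      s ''done'' 0 = 1 \<and> s ''found'' 0 = 0 \<and> \<not> feasible cap \<and> j = 0)"

text \<open>
  The state of a round before the search; \<open>r = n\<close> means that no node is overloaded.
\<close>

definition prepared :: "(nat \<Rightarrow> nat) \<Rightarrow> state \<Rightarrow> bool" where
  "prepared cap s \<longleftrightarrow> linked (s ''center'') m (s ''first'') (s ''next'') \<and>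
     (\<forall>v<n. s ''threshold'' v = threshold (deg v) (capped cap (s ''k'' 0) v) \<and>
        s ''load'' v = load (s ''center'') v \<and> s ''mark'' v = 0) \<and>
     (if s ''r'' 0 = n then fits (capped cap (s ''k'' 0)) (s ''center'')
      else s ''r'' 0 < n \<and> threshold (deg (s ''r'' 0)) (capped cap (s ''k'' 0) (s ''r'' 0))
             \<le> load (s ''center'') (s ''r'' 0))"

text \<open>
  The phases are the first components of a nested sequence; hence the formulation with a
  continuation \<open>P\<close>.
\<close>

lemma wp_prepare:
  assumes inputs: "inputs cap s" and deg: "s ''deg'' = deg" and c: "centers (s ''center'')"
    and rest: "\<And>k t. k \<le> 300 * (m + n + 1) \<Longrightarrow> prepared cap t \<Longrightarrow>
      (\<And>x. x \<notin> {''i'', ''limit'', ''threshold'', ''load'', ''first'', ''mark'', ''v'', ''next'', ''r''} \<Longrightarrow> t x = s x) \<Longrightarrow>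
      wp P (\<lambda>k'. Q (k + k')) t"
  shows "wp (Seq reset_nodes (Seq link_edges (Seq find_overloaded P))) Q s"
proof (rule wp_Seq, rule wp_frame[OF wp_reset_nodes[OF inputs deg]])
  fix k1 s1
  assume 1: "k1 \<le> (n + 1) * 100 \<and>
     (\<forall>v<n. s1 ''threshold'' v = threshold (deg v) (capped cap (s ''k'' 0) v) \<and>
        s1 ''load'' v = 0 \<and> s1 ''first'' v = 0 \<and> s1 ''mark'' v = 0)"
    and fr1: "\<And>x. x \<notin> writes reset_nodes \<Longrightarrow> s1 x = s x"
  have in1: "inputs cap s1" and c1: "s1 ''center'' = s ''center''" and k1: "s1 ''k'' = s ''k''"
    using inputs fr1 by (simp_all add: inputs_def)
  have "wp link_edges (\<lambda>k t. k \<le> (m + 1) * 100 \<and>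
     (\<forall>v<n. t ''load'' v = load (s1 ''center'') v) \<and>
     linked (s1 ''center'') m (t ''first'') (t ''next'')) s1"
    by (rule wp_link_edges[OF in1]) (use c c1 1 in auto)
  then show "wp (Seq link_edges (Seq find_overloaded P)) (\<lambda>k'. Q (k1 + k')) s1"
  proof (rule wp_Seq[OF wp_frame])
    fix k2 s2
    assume 2: "k2 \<le> (m + 1) * 100 \<and> (\<forall>v<n. s2 ''load'' v = load (s1 ''center'') v) \<and>
       linked (s1 ''center'') m (s2 ''first'') (s2 ''next'')"
      and fr2: "\<And>x. x \<notin> writes link_edges \<Longrightarrow> s2 x = s1 x"
    have in2: "inputs cap s2" using in1 fr2 by (simp add: inputs_def)
    show "wp (Seq find_overloaded P) (\<lambda>k'. Q (k1 + (k2 + k'))) s2"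
    proof (rule wp_Seq, rule wp_frame[OF wp_find_overloaded[OF in2]])
      fix k3 t
      assume 3: "k3 \<le> (n + 1) * 60 \<and>
         (if t ''r'' 0 = n then \<forall>v<n. s2 ''load'' v < s2 ''threshold'' v
          else t ''r'' 0 < n \<and> s2 ''threshold'' (t ''r'' 0) \<le> s2 ''load'' (t ''r'' 0))"
        and fr3: "\<And>x. x \<notin> writes find_overloaded \<Longrightarrow> t x = s2 x"
      have t: "t ''center'' = s ''center''" "t ''k'' = s ''k''" "t ''first'' = s2 ''first''"
        "t ''next'' = s2 ''next''" "t ''load'' = s2 ''load''" "t ''threshold'' = s1 ''threshold''"
        "s2 ''threshold'' = s1 ''threshold''" "t ''mark'' = s1 ''mark''"
        using fr1 fr2 fr3 by simp_all
      have "prepared cap t"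
        using 1 2 3 unfolding prepared_def t c1 fits_def by (auto split: if_splits)
      moreover have "k1 + (k2 + k3) \<le> 300 * (m + n + 1)" using 1 2 3 by simp
      moreover have "t x = s x"
        if "x \<notin> {''i'', ''limit'', ''threshold'', ''load'', ''first'', ''mark'', ''v'', ''next'', ''r''}" for x
        using fr1[of x] fr2[of x] fr3[of x] that by simp
      ultimately show "wp P (\<lambda>k'. Q (k1 + (k2 + (k3 + k')))) t"
        using rest[of "k1 + (k2 + k3)" t] by (simp add: add.assoc)
    qed
  qed
qed

lemma round_inv_step:
  assumes inv: "round_inv cap j s" and running: "s ''done'' 0 = 0"
  shows "inputs cap s" "s ''deg'' = deg" "centers (s ''center'')"
    "s ''k'' 0 = 1 \<or> \<not> feasible (capped cap (s ''k'' 0 - 1))" "s ''found'' 0 = 0"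
    "j = excess (capped cap (s ''k'' 0)) (s ''center'') + (m - s ''k'' 0) + 1"
  using assms unfolding round_inv_def by auto

lemma wp_round:
  assumes inv: "round_inv cap j s" and running: "s ''done'' 0 = 0"
  shows "wp round (\<lambda>k t. k \<le> 2000 * (m + n + 1) \<and> (\<exists>j'<j. round_inv cap j' t)) s"
  unfolding round_def
proof (rule wp_prepare[OF round_inv_step(1-3)[OF inv running]])
  note inv = round_inv_step[OF inv running]
  let ?c = "s ''center''"
  let ?l = "capped cap (s ''k'' 0)"
  fix k0 t
  assume k0: "k0 \<le> 300 * (m + n + 1)" and prep: "prepared cap t"
    and fr: "\<And>x. x \<notin> {''i'', ''limit'', ''threshold'', ''load'', ''first'', ''mark'', ''v'', ''next'', ''r''} \<Longrightarrow> t x = s x"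
  have same: "t ''center'' = ?c" "t ''k'' = s ''k''" "t ''deg'' = deg" "t ''found'' = s ''found''"
    "t ''done'' = s ''done''" and inputs: "inputs cap t"
    using fr inv(1,2) by (simp_all add: inputs_def)
  have n: "t ''n'' 0 = n" and m: "t ''m'' 0 = m" using inputs by (simp_all add: inputs_def)
  define full where "full = (\<lambda>v. t ''threshold'' v \<le> t ''load'' v + 1)"
  have full_iff: "full v \<longleftrightarrow> threshold (deg v) (?l v) \<le> load ?c v + 1" if "v < n" for v
    using prep that unfolding full_def prepared_def same by simp
  show "wp (com.If (Eq (var ''r'') (var ''n''))
        (Seq (setv ''found'' (N 1)) (setv ''done'' (N 1)))
        (Seq search
          (com.If (Eq (var ''hit'') (N 1)) flip_path
            (com.If (Less (var ''k'') (var ''m'')) (incr ''k'' (N 0)) (setv ''done'' (N 1))))))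
      (\<lambda>k'. (\<lambda>k t. k \<le> 2000 * (m + n + 1) \<and> (\<exists>j'<j. round_inv cap j' t)) (k0 + k')) t"
  proof (cases "t ''r'' 0 = n")
    case True
    then have "fits ?l ?c" using prep by (simp add: prepared_def same)
    then have "round_inv cap 0 (t(''found'' := (t ''found'')(0 := 1), ''done'' := (t ''done'')(0 := 1)))"
      using inv inputs unfolding round_inv_def by (simp add: same inputs_def)
    then show ?thesis
      by (intro wp_If_true wp_Seq wp_Write) (use True n k0 inv(6) in auto)
  next
    case False
    let ?r = "t ''r'' 0"
    have r: "?r < n" "threshold (deg ?r) (?l ?r) \<le> load ?c ?r"
      using prep False by (simp_all add: prepared_def same)
    have search: "wp search (\<lambda>k t'. k \<le> 500 * (m + 1) \<and> (\<exists>j. search_inv ?c full j t') \<and>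
        (t' ''h'' 0 = 0 \<or> t' ''hit'' 0 = 1)) t"
      using wp_search[of t full] inv(3) prep r(1) unfolding prepared_def same full_def by simp
    show ?thesis
    proof (rule wp_If_false, simp add: False n, rule wp_Seq, rule wp_frame[OF search])
      fix k1 u
      assume u: "k1 \<le> 500 * (m + 1) \<and> (\<exists>j. search_inv ?c full j u) \<and>
          (u ''h'' 0 = 0 \<or> u ''hit'' 0 = 1)"
        and fr_u: "\<And>x. x \<notin> writes search \<Longrightarrow> u x = t x"
      have same_u: "u ''center'' = ?c" "u ''k'' = s ''k''" "u ''deg'' = deg"
          "u ''found'' = s ''found''" "u ''done'' = s ''done''" "u ''r'' = t ''r''"
        and inputs_u: "inputs cap u"
        using fr_u inputs by (simp_all add: inputs_def same)
      have m_u: "u ''m'' 0 = m" using inputs_u by (simp add: inputs_def)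
      have dfs: "dfs_inv ?c full ?r (u ''first'') (u ''mark'') (u ''stack'') (u ''via'') (u ''h'' 0)"
        and hit: "u ''hit'' 0 = 0 \<or> u ''hit'' 0 = 1 \<and> 0 < u ''h'' 0 \<and> \<not> full (u ''stack'' (u ''h'' 0 - 1))"
        using u unfolding search_inv_def same_u by auto
      show "wp (com.If (Eq (var ''hit'') (N 1)) flip_path
            (com.If (Less (var ''k'') (var ''m'')) (incr ''k'' (N 0)) (setv ''done'' (N 1))))
        (\<lambda>k' t. k0 + (1 + bcost (Eq (var ''r'') (var ''n'')) + (k1 + k')) \<le> 2000 * (m + n + 1) \<and>
           (\<exists>j'<j. round_inv cap j' t)) u"
      proof (cases "u ''hit'' 0 = 1")
        case True
        then have "0 < u ''h'' 0" using hit by simp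
        then obtain h where h: "u ''h'' 0 = Suc h" using gr0_implies_Suc by blast
        let ?x = "u ''stack'' h"
        have x: "?x < n" using dfs_invD(3)[OF dfs, of h] h by simp
        have room: "load ?c ?x + 1 < threshold (deg ?x) (?l ?x)"
          using hit h True full_iff[OF x] by simp
        have "wp flip_path (\<lambda>k t'. k \<le> 60 * (n + 2) \<and> centers (t' ''center'') \<and>
            (\<forall>v. load (t' ''center'') v + of_bool (v = ?r) = load ?c v + of_bool (v = ?x))) u"
          using wp_flip_path[OF inputs_u _ _ h, of full ?r] inv(3) dfs unfolding same_u by blast
        then show ?thesis
        proof (rule wp_If_true[rotated, OF wp_frame])
          show "bval (Eq (var ''hit'') (N 1)) u" using True by simp
          fix k2 w
          assume w: "k2 \<le> 60 * (n + 2) \<and> centers (w ''center'') \<and>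
            (\<forall>v. load (w ''center'') v + of_bool (v = ?r) = load ?c v + of_bool (v = ?x))"
            and fr_w: "\<And>x. x \<notin> writes flip_path \<Longrightarrow> w x = u x"
          have less: "excess ?l (w ''center'') < excess ?l ?c"
            by (rule excess_path_flip[OF r(1) x _ r(2) room]) (use w in blast)
          have "round_inv cap (excess ?l (w ''center'') + (m - s ''k'' 0) + 1) w"
            using w fr_w inputs_u inv(4,5) running
            unfolding round_inv_def by (simp add: inputs_def same_u)
          moreover have "excess ?l (w ''center'') + (m - s ''k'' 0) + 1 < j" using less inv(6) by simp
          moreover have "k0 + (1 + bcost (Eq (var ''r'') (var ''n'')) +
              (k1 + (1 + bcost (Eq (var ''hit'') (N 1)) + k2))) \<le> 2000 * (m + n + 1)"
            using k0 u w by simp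
          ultimately show "k0 + (1 + bcost (Eq (var ''r'') (var ''n'')) +
              (k1 + (1 + bcost (Eq (var ''hit'') (N 1)) + k2))) \<le> 2000 * (m + n + 1) \<and>
            (\<exists>j'<j. round_inv cap j' w)"
            by blast
        qed
      next
        case no_hit: False
        then have h: "u ''h'' 0 = 0" using u by simp
        have infeasible: "\<not> feasible ?l"
          by (rule dfs_exhausted[where l = ?l, OF inv(3) dfs[unfolded h] _ r(2)]) (use full_iff in blast)
        show ?thesis
        proof (cases "s ''k'' 0 < m")
          case True
          have "excess (capped cap (Suc (s ''k'' 0))) ?c \<le> excess ?l ?c"
            by (rule excess_antimono) simp
          then have "excess (capped cap (Suc (s ''k'' 0))) ?c + (m - Suc (s ''k'' 0)) + 1 < j"
            using inv(6) True by simp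
          moreover have "round_inv cap (excess (capped cap (Suc (s ''k'' 0))) ?c + (m - Suc (s ''k'' 0)) + 1)
              (u(''k'' := (u ''k'')(0 := Suc (s ''k'' 0))))"
            using inputs_u inv(3,5) running infeasible
            unfolding round_inv_def by (simp add: inputs_def same_u)
          ultimately have "\<exists>j'<j. round_inv cap j' (u(''k'' := (u ''k'')(0 := Suc (s ''k'' 0))))"
            by blast
          then show ?thesis
            by (intro wp_If_false wp_If_true wp_Write) (use no_hit True m_u k0 u in \<open>simp_all add: same_u\<close>)
        next
          case False
          have "threshold (deg v) (?l v) = threshold (deg v) (cap v)" for v
            using False deg_le[of v] by (intro threshold_min) simp
          then have "\<not> feasible cap" using infeasible by (simp add: feasible_def fits_def)
          then have "round_inv cap 0 (u(''done'' := (u ''done'')(0 := 1)))"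
            using inputs_u inv(3,4,5) unfolding round_inv_def by (simp add: inputs_def same_u)
          then have "\<exists>j'<j. round_inv cap j' (u(''done'' := (u ''done'')(0 := 1)))" using inv(6) by (intro exI[of _ 0]) simp
          then show ?thesis
            by (intro wp_If_false wp_Write) (use no_hit False m_u k0 u in \<open>simp_all add: same_u\<close>)
        qed
      qed
    qed
  qed
qed

lemma wp_min_star_coloring:
  assumes inputs: "inputs cap s" and zero: "s ''deg'' = (\<lambda>_. 0)" "s ''done'' 0 = 0" "s ''found'' 0 = 0"
  shows "wp min_star_coloring (\<lambda>k t. k \<le> 5000 * (m + n + 1) * (2 * m + n + 2) \<and> (\<exists>j. round_inv cap j t) \<and>
     t ''done'' 0 \<noteq> 0) s"
  unfolding min_star_coloring_def
proof (rule wp_Seq, rule wp_frame[OF wp_initialize[OF inputs zero(1)]])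
  fix k0 t
  assume t: "k0 \<le> (m + 1) * 60 \<and> t ''k'' 0 = 1 \<and> t ''deg'' = deg \<and> centers (t ''center'')"
    and fr: "\<And>x. x \<notin> writes initialize \<Longrightarrow> t x = s x"
  let ?j = "excess (capped cap 1) (t ''center'') + (m - 1) + 1"
  let ?b = "Eq (var ''done'') (N 0)"
  have "wp (While ?b round) (\<lambda>k t. k \<le> (?j + 1) * (1 + bcost ?b + 2000 * (m + n + 1)) \<and>
      (\<exists>j'\<le>?j. round_inv cap j' t) \<and> \<not> bval ?b t) t"
  proof (rule wp_While)
    show "round_inv cap ?j t"
      using t fr inputs zero unfolding round_inv_def by (simp add: inputs_def)
  qed (use wp_round in simp)
  then show "wp (While ?b round) (\<lambda>k' t. k0 + k' \<le> 5000 * (m + n + 1) * (2 * m + n + 2) \<and>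
      (\<exists>j. round_inv cap j t) \<and> t ''done'' 0 \<noteq> 0) t"
  proof (rule wp_mono)
    fix k u
    assume u: "k \<le> (?j + 1) * (1 + bcost ?b + 2000 * (m + n + 1)) \<and>
      (\<exists>j'\<le>?j. round_inv cap j' u) \<and> \<not> bval ?b u"
    have "?j + 1 \<le> 2 * m + n + 2" using excess_le[of "capped cap 1" "t ''center''"] by linarith
    then have "(?j + 1) * (1 + bcost ?b + 2000 * (m + n + 1)) \<le> (2 * m + n + 2) * (3000 * (m + n + 1))"
      by (intro mult_le_mono) simp_all
    moreover have "(m + 1) * 60 \<le> (2 * m + n + 2) * (60 * (m + n + 1))" by (simp add: algebra_simps)
    ultimately have "k0 + k \<le> (2 * m + n + 2) * (60 * (m + n + 1)) + (2 * m + n + 2) * (3000 * (m + n + 1))"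
      using t u by linarith
    also have "\<dots> \<le> 5000 * (m + n + 1) * (2 * m + n + 2)" by (simp add: algebra_simps)
    finally show "k0 + k \<le> 5000 * (m + n + 1) * (2 * m + n + 2) \<and> (\<exists>j. round_inv cap j u) \<and> u ''done'' 0 \<noteq> 0"
      using u by auto
  qed
qed

end

section \<open>Correctness and running time\<close>

context represented_graph
begin

lemma inputs_input_state: "inputs cap (input_state vs es \<kappa>)"
  by (simp add: inputs_def input_state_def scalar_def)

lemma min_star_coloring_correct:
  "\<exists>k t. exec min_star_coloring (input_state vs es \<kappa>) k t \<and>
     k \<le> 5000 * (length es + length vs + 1) * (2 * length es + length vs + 2) \<and>
     correct_output V E \<kappa> col vs es t"
proof -
  have "wp min_star_coloring (\<lambda>k t.
      k \<le> 5000 * (length es + length vs + 1) * (2 * length es + length vs + 2) \<and>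
      (\<exists>j. round_inv cap j t) \<and> t ''done'' 0 \<noteq> 0) (input_state vs es \<kappa>)"
    by (rule wp_min_star_coloring[OF inputs_input_state]) (simp_all add: input_state_def)
  moreover have "correct_output V E \<kappa> col vs es t" if "round_inv cap j t" "t ''done'' 0 \<noteq> 0" for j t
  proof -
    have c: "centers (t ''center'')"
      and minimal: "t ''k'' 0 = 1 \<or> \<not> feasible (capped cap (t ''k'' 0 - 1))"
      and "t ''found'' 0 = 1 \<and> fits (capped cap (t ''k'' 0)) (t ''center'') \<or>
        t ''found'' 0 = 0 \<and> \<not> feasible cap"
      using that unfolding round_inv_def by auto
    then show ?thesis
      using correct_output_if_minimal[of t, OF c _ minimal] correct_output_if_infeasible[of t] by blast
  qed
  ultimately show ?thesis unfolding wp_def by blast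
qed

end

theorem theorem1:
  "\<exists>(P :: com) (T :: nat \<Rightarrow> nat).
     (\<lambda>m. real (T m)) \<in> O(\<lambda>m. (real m)\<^sup>2) \<and>
     (\<forall>(V :: 'v set) E (\<kappa> :: 'v \<Rightarrow> nat) (col :: 'v \<Rightarrow> 'c) vs es.
        simple_graph V E \<and> V \<noteq> {} \<and> connected_graph V E \<and> inj_on col V \<and>
        represents vs es V E \<longrightarrow>
        (\<exists>k t. exec P (input_state vs es \<kappa>) k t \<and> k \<le> T (card E) \<and>
               correct_output V E \<kappa> col vs es t))"
proof (rule exI[of _ min_star_coloring], rule exI[of _ "\<lambda>m. 30000 * (m + 1) * (m + 1)"],
    intro conjI allI impI)
  let ?T = "\<lambda>m :: nat. 30000 * (m + 1) * (m + 1)"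
  show "(\<lambda>m. real (?T m)) \<in> O(\<lambda>m. (real m)\<^sup>2)"
  proof (rule bigoI)
    show "\<forall>\<^sub>F m in at_top. norm (real (?T m)) \<le> 120000 * norm ((real m)\<^sup>2)"
    proof (rule eventually_mono[OF eventually_ge_at_top[of 1]])
      fix m :: nat assume "1 \<le> m"
      then have "?T m \<le> 30000 * (2 * m) * (2 * m)" by (intro mult_le_mono) simp_all
      then have "real (?T m) \<le> real (30000 * (2 * m) * (2 * m))" by (rule of_nat_mono)
      then show "norm (real (?T m)) \<le> 120000 * norm ((real m)\<^sup>2)"
        by (simp add: power2_eq_square)
    qed
  qed
  fix V :: "'v set" and E and \<kappa> :: "'v \<Rightarrow> nat" and col :: "'v \<Rightarrow> 'c" and vs es
  assume *: "simple_graph V E \<and> V \<noteq> {} \<and> connected_graph V E \<and> inj_on col V \<and> represents vs es V E"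
  then interpret represented_graph V E col vs es \<kappa> by unfold_locales auto
  have "length vs = card V" using distinct_card[OF distinct_vs] set_vs by simp
  then have n: "length vs \<le> card E + 1" using connected_graph_card_le * by auto
  have "5000 * (length es + length vs + 1) * (2 * length es + length vs + 2) \<le>
      5000 * (2 * (card E + 1)) * (3 * (card E + 1))"
    using n unfolding card_E by (intro mult_le_mono) simp_all
  also have "\<dots> = ?T (card E)" by (simp add: algebra_simps)
  finally show "\<exists>k t. exec min_star_coloring (input_state vs es \<kappa>) k t \<and> k \<le> ?T (card E) \<and>
      correct_output V E \<kappa> col vs es t"
    using min_star_coloring_correct by (meson le_trans)
qed

end
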